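(* Let $\{\mathbf X_t\}=\{(X_{1,t},X_{2,t})^T\}$ be a strictly stationary and ergodic BRCMNBINAR(1) process with $\phi=\mathrm{Cov}(Z_{1,t},Z_{2,t})$, and let $\hat\phi^{CLS}$ be the conditional least squares estimator of $\phi$ based on $\mathbf X_1,\dots,\mathbf X_n$, i.e. the minimizer over $\phi\in\mathbb R$ of $$S_2(\phi)=\sum_{t=2}^n\big[(X_{1,t}-E(X_{1,t}\mid\mathbf X_{t-1}))(X_{2,t}-E(X_{2,t}\mid\mathbf X_{t-1}))-\phi\big]^2 ,$$ where $E(X_{i,t}\mid\mathbf X_{t-1})=m_i(X_{i,t-1}+1)/l+\mu_i$. If $E|X_{i,t}|^4<\infty$ for $i=1,2$, then as $n\to\infty$ the estimator $\hat\phi^{CLS}$ is strongly consistent ($\hat\phi^{CLS}\to\phi$ almost surely) and asymptotically normal: $$\sqrt{n-1}\,(\hat\phi^{CLS}-\phi)\xrightarrow{L}N(0,\delta^2),$$ where $\delta^2=E\big[(X_{1,t}-m_1(X_{1,t-1}+1)/l-\mu_1)(X_{2,t}-m_2(X_{2,t-1}+1)/l-\mu_2)-\phi\big]^2$ and $\xrightarrow{L}$ denotes convergence in distribution.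
   Context: $\mathbb N_0=\{0,1,2,\dots\}$. Modified negative binomial operator: for $\alpha>0$ and an $\mathbb N_0$-valued random variable $X$, $\alpha\diamond X=\sum_{j=1}^{X+1}G_j$, where $\{G_j\}$ are i.i.d. geometric with parameter $\frac{\alpha}{1+\alpha}$, i.e. $P(G_j=k)=\frac{\alpha^k}{(1+\alpha)^{k+1}}$, $k\in\mathbb N_0$ (mean $\alpha$), independent of $X$. When $\alpha$ is random, this is understood conditionally on $\alpha$. BRCMNBINAR(1) process: an $\mathbb N_0^2$-valued process $\mathbf X_t=(X_{1,t},X_{2,t})^T$ with $X_{i,t}=\alpha_{i,t}\diamond X_{i,t-1}+Z_{i,t}$, $i=1,2$, $t\in\mathbb N$, where: (i) for $i=1,2$, $\{\alpha_{i,t}\}_t$ is i.i.d. Beta prime with density $f(x)=x^{m_i-1}(1+x)^{-m_i-l-1}/B(m_i,l+1)$, $x>0$ ($B$ is the Beta function), where $l>1$ is a known constant and $0<m_i<l$; so $E(\alpha_{i,t})=\alpha_i=m_i/l$ and $\mathrm{Var}(\alpha_{i,t})=\sigma_{\alpha_i}^2=\frac{m_i(m_i+l)}{(l-1)l^2}$; $\{\alpha_{1,t}\}$ and $\{\alpha_{2,t}\}$ are mutually independent; (ii) $\mathbf Z_t=(Z_{1,t},Z_{2,t})^T$ are i.i.d. $\mathbb N_0^2$-valued random vectors with joint pmf $f_{\mathbf Z}(x,y)$, $E(Z_{i,t})=\mu_i$, $\mathrm{Var}(Z_{i,t})=\sigma_{Z_i}^2<\infty$, $\mathrm{Cov}(Z_{1,t},Z_{2,t})=\phi$;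 $\mathbf Z_t$ is independent of $(\alpha_{1,t}\diamond X_{1,t-1},\alpha_{2,t}\diamond X_{2,t-1})$ and of $\mathbf X_s$ for $s<t$; (iii) given the coefficients $\alpha_{i,t}$, the counting variables $G_j$ used in different components $i$ and at different times $t$ are independent; the triples (coefficients $(\alpha_{1,t},\alpha_{2,t})$, counting variables at time $t$, $\mathbf Z_t$) are independent over $t$ and independent of $\mathbf X_s$, $s<t$; (iv) $(m_1,\mu_1)\neq(m_2,\mu_2)$. In $S_2$ the parameters $m_i,\mu_i$ entering the conditional expectations are the true ones. *)

theory Defs
  imports "HOL-Probability.Probability"
begin

text \<open>The pmf of the geometric law with parameter \<open>a / (1 + a)\<close>, whose mean is \<open>a\<close>.\<close>

definition geom_pmf :: "real \<Rightarrow> nat \<Rightarrow> real" where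
  "geom_pmf a k = a ^ k / (1 + a) ^ (k + 1)"

definition beta_prime_density :: "real \<Rightarrow> real \<Rightarrow> real \<Rightarrow> real" where
  "beta_prime_density m l x =
     (if 0 < x then x powr (m - 1) * (1 + x) powr (- m - l - 1) / Beta m (l + 1) else 0)"

text \<open>The modified negative binomial operator, with counting variables \<open>G 0, G 1, \<dots>\<close>: a sum of
  \<open>X + 1\<close> terms. The coefficient enters only through the (conditional) law of \<open>G\<close>.\<close>

definition nb_op :: "(nat \<Rightarrow> 'a \<Rightarrow> nat) \<Rightarrow> ('a \<Rightarrow> nat) \<Rightarrow> 'a \<Rightarrow> nat" where
  "nb_op G X \<omega> = (\<Sum>j<X \<omega> + 1. G j \<omega>)"

text \<open>The two components are indexed by the numeral type \<open>2\<close>, whose elements are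
  \<open>1\<close> and \<open>2\<close> (where \<open>2 = 0\<close>).\<close>

definition both :: "(2 \<Rightarrow> nat \<Rightarrow> 'a \<Rightarrow> nat) \<Rightarrow> nat \<Rightarrow> 'a \<Rightarrow> nat \<times> nat" where
  "both X t \<omega> = (X 1 t \<omega>, X 2 t \<omega>)"

definition strictly_stationary :: "'a measure \<Rightarrow> 'b measure \<Rightarrow> (nat \<Rightarrow> 'a \<Rightarrow> 'b) \<Rightarrow> bool" where
  "strictly_stationary M S Y \<longleftrightarrow>
     (\<forall>h. distr M (Pi\<^sub>M UNIV (\<lambda>_. S)) (\<lambda>\<omega> t. Y (t + h) \<omega>) =
          distr M (Pi\<^sub>M UNIV (\<lambda>_. S)) (\<lambda>\<omega> t. Y t \<omega>))"

text \<open>Ergodicity of the path law under the shift: shift-invariant events are trivial.\<close>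

definition ergodic_process :: "'a measure \<Rightarrow> 'b measure \<Rightarrow> (nat \<Rightarrow> 'a \<Rightarrow> 'b) \<Rightarrow> bool" where
  "ergodic_process M S Y \<longleftrightarrow>
     (\<forall>A \<in> sets (Pi\<^sub>M UNIV (\<lambda>_. S)).
        {x \<in> space (Pi\<^sub>M UNIV (\<lambda>_. S)). (\<lambda>t. x (Suc t)) \<in> A} = A \<longrightarrow>
        measure M {\<omega> \<in> space M. (\<lambda>t. Y t \<omega>) \<in> A} \<in> {0, 1})"

text \<open>The library's \<^const>\<open>prob_space.indep_var\<close> requires both variables to take values in the same type;
  this is the same notion without that restriction.\<close>

definition (in prob_space) indep_rv ::
    "'b measure \<Rightarrow> ('a \<Rightarrow> 'b) \<Rightarrow> 'c measure \<Rightarrow> ('a \<Rightarrow> 'c) \<Rightarrow> bool" where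
  "indep_rv N U N' V \<longleftrightarrow>
     random_variable N U \<and> random_variable N' V \<and>
     indep_set {U -` A \<inter> space M | A. A \<in> sets N} {V -` A \<inter> space M | A. A \<in> sets N'}"

text \<open>Time starts at \<open>0\<close>; coefficients \<open>\<alpha>\<close>, counting variables \<open>G\<close> and innovations \<open>Z\<close> matter
  only for times \<open>t \<ge> 1\<close>. Arguments are ordered component, time, (number of the counting
  variable), sample point.\<close>

locale brcmnbinar = prob_space M
  for M :: "'a measure" +
  fixes l :: real
    and m \<mu> \<sigma>Z2 :: "2 \<Rightarrow> real"
    and \<phi> :: real
    and fZ :: "(nat \<times> nat) pmf"
    and \<alpha> :: "2 \<Rightarrow> nat \<Rightarrow> 'a \<Rightarrow> real"
    and G :: "2 \<Rightarrow> nat \<Rightarrow> nat \<Rightarrow> 'a \<Rightarrow> nat"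
    and Z :: "2 \<Rightarrow> nat \<Rightarrow> 'a \<Rightarrow> nat"
    and X :: "2 \<Rightarrow> nat \<Rightarrow> 'a \<Rightarrow> nat"
  assumes l_gt_1: "1 < l"
    and m_bounds: "\<And>i. 0 < m i \<and> m i < l"
    and X_measurable: "\<And>i t. X i t \<in> measurable M (count_space UNIV)"
    and G_measurable: "\<And>i t j. 1 \<le> t \<Longrightarrow> G i t j \<in> measurable M (count_space UNIV)"
    and Z_measurable: "\<And>i t. 1 \<le> t \<Longrightarrow> Z i t \<in> measurable M (count_space UNIV)"
    and recursion: "\<And>i t. 1 \<le> t \<Longrightarrow>
          AE \<omega> in M. X i t \<omega> = nb_op (G i t) (X i (t - 1)) \<omega> + Z i t \<omega>"
    \<comment> \<open>random coefficients\<close>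
    and \<alpha>_distributed: "\<And>i t. 1 \<le> t \<Longrightarrow>
          distributed M lborel (\<alpha> i t) (\<lambda>x. ennreal (beta_prime_density (m i) l x))"
    and \<alpha>_indep: "\<And>i. indep_vars (\<lambda>_. borel) (\<lambda>t. \<alpha> i t) {1..}"
    and \<alpha>_mutually_indep:
          "indep_var (Pi\<^sub>M {1..} (\<lambda>_. borel)) (\<lambda>\<omega>. \<lambda>t\<in>{1..}. \<alpha> 1 t \<omega>)
                     (Pi\<^sub>M {1..} (\<lambda>_. borel)) (\<lambda>\<omega>. \<lambda>t\<in>{1..}. \<alpha> 2 t \<omega>)"
    \<comment> \<open>innovations\<close>
    and Z_law: "\<And>t. 1 \<le> t \<Longrightarrow> distr M (count_space UNIV) (both Z t) = measure_pmf fZ"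
    and Z_indep: "indep_vars (\<lambda>_. count_space UNIV) (\<lambda>t. both Z t) {1..}"
    and Z_square_integrable: "\<And>i t. 1 \<le> t \<Longrightarrow> integrable M (\<lambda>\<omega>. (real (Z i t \<omega>))\<^sup>2)"
    and Z_mean: "\<And>i t. 1 \<le> t \<Longrightarrow> expectation (\<lambda>\<omega>. real (Z i t \<omega>)) = \<mu> i"
    and Z_variance: "\<And>i t. 1 \<le> t \<Longrightarrow> variance (\<lambda>\<omega>. real (Z i t \<omega>)) = \<sigma>Z2 i"
    and Z_covariance: "\<And>t. 1 \<le> t \<Longrightarrow>
          expectation (\<lambda>\<omega>. (real (Z 1 t \<omega>) - \<mu> 1) * (real (Z 2 t \<omega>) - \<mu> 2)) = \<phi>"
    and Z_indep_thinned_past: "\<And>t. 1 \<le> t \<Longrightarrow>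
          indep_rv (count_space UNIV) (both Z t)
            (count_space UNIV \<Otimes>\<^sub>M Pi\<^sub>M {..<t} (\<lambda>_. count_space UNIV))
            (\<lambda>\<omega>. ((nb_op (G 1 t) (X 1 (t - 1)) \<omega>, nb_op (G 2 t) (X 2 (t - 1)) \<omega>),
                  \<lambda>s\<in>{..<t}. both X s \<omega>))"
    \<comment> \<open>Given all coefficients, the counting variables of all components and times are
        independent and geometric, expressed through their finite-dimensional conditional laws.\<close>
    and G_conditional: "\<And>J k. finite J \<Longrightarrow> J \<subseteq> UNIV \<times> {1..} \<times> UNIV \<Longrightarrow>
          AE \<omega> in M.
            real_cond_exp M
              (vimage_algebra (space M) (\<lambda>\<omega>. \<lambda>(i, t)\<in>UNIV \<times> {1..}. \<alpha> i t \<omega>)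
                 (Pi\<^sub>M (UNIV \<times> {1..}) (\<lambda>_. borel)))
              (indicator {\<omega> \<in> space M. \<forall>(i, t, j)\<in>J. G i t j \<omega> = k i t j}) \<omega> =
            (\<Prod>(i, t, j)\<in>J. geom_pmf (\<alpha> i t \<omega>) (k i t j))"
    \<comment> \<open>The triples (coefficients, counting variables, innovations) are independent over time,
        and each is independent of the past of the process.\<close>
    and triples_indep:
          "indep_vars
             (\<lambda>_. Pi\<^sub>M UNIV (\<lambda>_. borel) \<Otimes>\<^sub>M Pi\<^sub>M UNIV (\<lambda>_. count_space UNIV) \<Otimes>\<^sub>M count_space UNIV)
             (\<lambda>t \<omega>. (\<lambda>i. \<alpha> i t \<omega>, \<lambda>(i, j). G i t j \<omega>, both Z t \<omega>)) {1..}"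
    and triple_indep_past: "\<And>t. 1 \<le> t \<Longrightarrow>
          indep_rv
            (Pi\<^sub>M UNIV (\<lambda>_. borel) \<Otimes>\<^sub>M Pi\<^sub>M UNIV (\<lambda>_. count_space UNIV) \<Otimes>\<^sub>M count_space UNIV)
            (\<lambda>\<omega>. (\<lambda>i. \<alpha> i t \<omega>, \<lambda>(i, j). G i t j \<omega>, both Z t \<omega>))
            (Pi\<^sub>M {..<t} (\<lambda>_. count_space UNIV)) (\<lambda>\<omega>. \<lambda>s\<in>{..<t}. both X s \<omega>)"
    and components_differ: "(m 1, \<mu> 1) \<noteq> (m 2, \<mu> 2)"

definition cond_mean ::
    "'a measure \<Rightarrow> (2 \<Rightarrow> nat \<Rightarrow> 'a \<Rightarrow> nat) \<Rightarrow> 2 \<Rightarrow> nat \<Rightarrow> 'a \<Rightarrow> real" where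
  "cond_mean M X i t =
     real_cond_exp M (vimage_algebra (space M) (both X (t - 1)) (count_space UNIV))
       (\<lambda>\<omega>. real (X i t \<omega>))"

definition S2 ::
    "'a measure \<Rightarrow> (2 \<Rightarrow> nat \<Rightarrow> 'a \<Rightarrow> nat) \<Rightarrow> nat \<Rightarrow> 'a \<Rightarrow> real \<Rightarrow> real" where
  "S2 M X n \<omega> p =
     (\<Sum>t = 2..n. ((real (X 1 t \<omega>) - cond_mean M X 1 t \<omega>) *
                   (real (X 2 t \<omega>) - cond_mean M X 2 t \<omega>) - p)\<^sup>2)"

text \<open>For \<open>n \<ge> 2\<close> the minimizer is unique; for \<open>n < 2\<close> the value is an irrelevant constant.\<close>

definition phi_CLS :: "'a measure \<Rightarrow> (2 \<Rightarrow> nat \<Rightarrow> 'a \<Rightarrow> nat) \<Rightarrow> nat \<Rightarrow> 'a \<Rightarrow> real" where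
  "phi_CLS M X n \<omega> = arg_min (S2 M X n \<omega>) (\<lambda>_. True)"

definition delta2 ::
    "'a measure \<Rightarrow> real \<Rightarrow> (2 \<Rightarrow> real) \<Rightarrow> (2 \<Rightarrow> real) \<Rightarrow> real \<Rightarrow>
     (2 \<Rightarrow> nat \<Rightarrow> 'a \<Rightarrow> nat) \<Rightarrow> nat \<Rightarrow> real" where
  "delta2 M l m \<mu> \<phi> X t =
     (\<integral>\<omega>. ((real (X 1 t \<omega>) - m 1 * (real (X 1 (t - 1) \<omega>) + 1) / l - \<mu> 1) *
          (real (X 2 t \<omega>) - m 2 * (real (X 2 (t - 1) \<omega>) + 1) / l - \<mu> 2) - \<phi>)\<^sup>2 \<partial>M)"

text \<open>The normal law with mean \<open>a\<close> and variance \<open>v \<ge> 0\<close>; a point mass if \<open>v = 0\<close>, where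
  \<^const>\<open>normal_density\<close> degenerates.\<close>

definition normal_law :: "real \<Rightarrow> real \<Rightarrow> real measure" where
  "normal_law a v =
     (if v = 0 then return borel a
      else density lborel (\<lambda>x. ennreal (normal_density a (sqrt v) x)))"

end

theory Submission
  imports Defs
begin

text \<open>Completing the square identifies the estimator with the average of the products of residuals,
  so its error is an average of the sequence \<open>\<epsilon>\<^sub>t = r\<^sub>1\<^sub>t r\<^sub>2\<^sub>t - \<phi>\<close>. Given the past, the thinned parts
  have conditional means \<open>m\<^sub>i (X\<^sub>i + 1) / l\<close> and are conditionally uncorrelated, because the two
  coefficients are independent; hence \<open>\<epsilon>\<close> is a stationary ergodic sequence of martingale
  differences, square integrable by the fourth-moment hypothesis. Birkhoff's theorem applied to \<open>\<epsilon>\<close>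
  gives strong consistency. Applied to \<open>\<epsilon>\<^sup>2\<close> it makes the normalised quadratic variation converge almost
  surely to the variance, which is all that McLeish's argument for the martingale central limit theorem
  needs: \<open>\<Prod>(1 + \<i> u \<epsilon>\<^sub>t / \<surd>n)\<close> has expectation \<open>1\<close> and differs asymptotically from
  \<open>exp (\<i> u \<Sum>\<epsilon>\<^sub>t / \<surd>n)\<close> only by the factor \<open>exp (u\<^sup>2 \<delta>\<^sup>2 / 2)\<close>.\<close>

section \<open>Birkhoff's ergodic theorem\<close>

text \<open>The obstacle in the limit theorem is integrability: with second moments alone the
  product of the factors \<open>1 + \<i> u \<epsilon>\<^sub>t / \<surd>n\<close> need not even be
  integrable. It is therefore cut off by a predictable indicator that switches off all increments
  once the accumulated squares exceed \<open>(s + 1) n\<close>. Predictability keeps the expectation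
  at \<open>1\<close>, the cut-off gives an L2 bound uniform in \<open>n\<close>, and almost sure
  convergence of the averaged squares makes it eventually invisible along almost every path.
  Ergodicity supplies a constant limit \<open>s\<close>, so that the Gaussian factor can leave the
  expectation. On the side of the model, the thinning is a sum of random length with mixed summands.
  Its moments are computed as nonnegative integrals, where sums and expectations may be exchanged
  freely; integrability is added afterwards from the moments of \<open>X\<close>. Conditional
  statements are derived from unconditional identities tested against bounded nonnegative functions
  of the past, and the only coefficient moments that enter are the two means and the mean of the
  product.\<close>

context prob_space
begin

text \<open>The set where the sums are unbounded is invariant, so it is null or has full measure. In
  the second case the running maxima \<open>R n\<close> grow beyond every bound and
  \<open>R (Suc n) - R n \<circ> T\<close> tends to \<open>f\<close>; its expectation is nonnegative
  by invariance of the measure and monotonicity in \<open>n\<close>, which contradicts the negative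
  mean.\<close>

lemma birkhoff_sums_bdd_above:
  fixes f :: "'a \<Rightarrow> real"
  assumes T [measurable]: "T \<in> measurable M M" and inv: "distr M M T = M"
    and erg: "\<And>A. A \<in> sets M \<Longrightarrow> T -` A \<inter> space M = A \<Longrightarrow> prob A \<in> {0, 1}"
    and f: "integrable M f" and neg: "expectation f < 0"
  shows "AE x in M. bdd_above (range (\<lambda>n. \<Sum>k<n. f ((T ^^ k) x)))"
proof -
  note [measurable] = borel_measurable_integrable[OF f]
  define S where "S n x = (\<Sum>k<n. f ((T ^^ k) x))" for n x
  have S_Suc: "S (Suc n) x = f x + S n (T x)" for n x
    unfolding S_def by (subst sum.lessThan_Suc_shift) (simp add: funpow_swap1)
  have [measurable]: "T ^^ k \<in> measurable M M" for k
    by (induction k) (auto simp: id_def)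
  have [measurable]: "S n \<in> borel_measurable M" for n
    unfolding S_def by measurable
  \<comment> \<open>Bounds are taken in the naturals, so that unboundedness is a countable
    intersection and \<open>A\<close> is measurable.\<close>
  define A where "A = {x \<in> space M. \<forall>K::nat. \<exists>n. S n x > K}"
  have A_sets [measurable]: "A \<in> sets M" unfolding A_def by measurable
  have A_bdd: "x \<in> A \<longleftrightarrow> \<not> bdd_above (range (\<lambda>n. S n x))" if "x \<in> space M" for x
  proof -
    have "bdd_above (range (\<lambda>n. S n x)) \<longleftrightarrow> (\<exists>K::nat. \<forall>n. S n x \<le> K)"
      unfolding bdd_above_def by (auto intro: order_trans[OF _ real_nat_ceiling_ge])
    then show ?thesis using that unfolding A_def by (auto simp: not_le)
  qed
  have T_space: "T x \<in> space M" if "x \<in> space M" for x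
    using that T by (rule measurable_space[rotated])
  have step: "bdd_above (range (\<lambda>n. S n (T x))) \<longleftrightarrow> bdd_above (range (\<lambda>n. S n x))" for x
  proof
    assume "bdd_above (range (\<lambda>n. S n (T x)))"
    then obtain K where K: "\<And>n. S n (T x) \<le> K" by (auto simp: bdd_above_def)
    have "S n x \<le> max 0 (f x + K)" for n
      using K[of "n - 1"] S_Suc[of "n - 1" x] by (cases n) (auto simp: S_def)
    then show "bdd_above (range (\<lambda>n. S n x))" by (auto intro!: bdd_aboveI)
  next
    assume "bdd_above (range (\<lambda>n. S n x))"
    then obtain K where K: "\<And>n. S n x \<le> K" by (auto simp: bdd_above_def)
    have "S n (T x) \<le> K - f x" for n
      using K[of "Suc n"] S_Suc[of n x] by simp
    then show "bdd_above (range (\<lambda>n. S n (T x)))" by (auto intro!: bdd_aboveI)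
  qed
  have "T -` A \<inter> space M = A"
  proof (rule set_eqI)
    fix x show "x \<in> T -` A \<inter> space M \<longleftrightarrow> x \<in> A"
      using A_bdd[of x] A_bdd[of "T x"] step[of x] T_space[of x] sets.sets_into_space[OF A_sets]
      by (cases "x \<in> space M") auto
  qed
  then have "prob A \<in> {0, 1}" using erg A_sets by blast
  moreover have "prob A \<noteq> 1"
  proof
    assume "prob A = 1"
    then have AE_A: "AE x in M. x \<in> A" by (simp add: prob_eq_1)
    \<comment> \<open>\<open>R n\<close> is the maximum of \<open>S 0, ..., S n\<close>; prefixing
      one term turns the maximum at \<open>T x\<close> into the next maximum at
      \<open>x\<close>.\<close>
    define R where "R = rec_nat (\<lambda>x. 0) (\<lambda>n g x. max 0 (f x + g (T x)))"
    have R_0: "R 0 x = 0" and R_Suc: "R (Suc n) x = max 0 (f x + R n (T x))" for n x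
      by (simp_all add: R_def)
    have R_pos: "0 \<le> R n x" for n x by (cases n) (auto simp: R_0 R_Suc)
    have R_S: "S n x \<le> R n x" for n x
      by (induction n arbitrary: x) (auto simp: R_0 R_Suc S_Suc S_def[of 0] max.coboundedI2)
    have R_mono1: "R n x \<le> R (Suc n) x" for n x
    proof (induction n arbitrary: x)
      case (Suc n)
      then show ?case by (subst (1 2) R_Suc) (intro max.mono add_left_mono order_refl)
    qed (simp add: R_0 R_Suc)
    have R_mono: "R n x \<le> R k x" if "n \<le> k" for n k x
      using that by (rule lift_Suc_mono_le[of "\<lambda>n. R n x", OF R_mono1])
    have comp_T: "integrable M (\<lambda>x. g (T x)) \<and> expectation (\<lambda>x. g (T x)) = expectation g"
      if g: "integrable M g" for g :: "'a \<Rightarrow> real"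
    proof -
      have "integrable (distr M M T) g" using g inv by simp
      then show ?thesis
        using integrable_distr[OF T] integral_distr[OF T borel_measurable_integrable[OF g]] inv
        by simp
    qed
    have R_int: "integrable M (R n)" for n
    proof (induction n)
      case 0 then show ?case by (simp add: R_0[abs_def])
    next
      case (Suc n)
      then show ?case unfolding R_Suc[abs_def] using f comp_T[of "R n"]
        by (intro Bochner_Integration.integrable_max) auto
    qed
    \<comment> \<open>As \<open>R n\<close> is nonnegative, \<open>max (- R n (T x)) (f x)\<close>
      never exceeds \<open>\<bar>f x\<bar>\<close> in modulus, which gives the dominating
      function.\<close>
    define d where "d n x = R (Suc n) x - R n (T x)" for n x
    have d_eq: "d n x = max (- R n (T x)) (f x)" for n x by (auto simp: d_def R_Suc)
    have d_meas [measurable]: "d n \<in> borel_measurable M" for n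
      unfolding d_def using R_int[THEN borel_measurable_integrable] by measurable
    have "(\<lambda>n. expectation (d n)) \<longlonglongrightarrow> expectation f"
    proof (rule integral_dominated_convergence[where w="\<lambda>x. \<bar>f x\<bar>"])
      show "AE x in M. (\<lambda>n. d n x) \<longlonglongrightarrow> f x"
        using AE_A
      proof (rule AE_mp, intro AE_I2 impI)
        fix x assume x: "x \<in> space M" "x \<in> A"
        then have "T x \<in> A" using A_bdd T_space step by blast
        then obtain n where n: "S n (T x) > nat \<lceil>\<bar>f x\<bar>\<rceil>" unfolding A_def by blast
        have "d k x = f x" if "n \<le> k" for k
        proof -
          have "R k (T x) \<ge> S n (T x)" using R_mono[OF that] R_S order_trans by blast
          then have "R k (T x) \<ge> \<bar>f x\<bar>" using n by linarith
          then show ?thesis by (simp add: d_eq)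
        qed
        then show "(\<lambda>n. d n x) \<longlonglongrightarrow> f x"
          by (intro tendsto_eventually) (auto simp: eventually_sequentially)
      qed
      show "AE x in M. norm (d n x) \<le> \<bar>f x\<bar>" for n
        using R_pos by (intro AE_I2) (auto simp: d_eq max_def abs_if; smt R_pos)
    qed (use f in auto)
    moreover have "expectation (d n) \<ge> 0" for n
    proof -
      have "expectation (d n) = expectation (R (Suc n)) - expectation (R n)"
        unfolding d_def using R_int comp_T[OF R_int[of n]] by simp
      also have "\<dots> \<ge> 0" using integral_mono[OF R_int R_int R_mono1] by simp
      finally show ?thesis .
    qed
    ultimately have "expectation f \<ge> 0" by (meson LIMSEQ_le_const)
    with neg show False by simp
  qed
  ultimately have "prob A = 0" by simp
  then have "AE x in M. x \<notin> A" using A_sets by (simp add: prob_eq_0)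
  then show ?thesis using A_bdd by (auto simp: S_def)
qed

theorem birkhoff_ergodic:
  fixes f :: "'a \<Rightarrow> real"
  assumes T: "T \<in> measurable M M" and inv: "distr M M T = M"
    and erg: "\<And>A. A \<in> sets M \<Longrightarrow> T -` A \<inter> space M = A \<Longrightarrow> prob A \<in> {0, 1}"
    and f: "integrable M f"
  shows "AE x in M. (\<lambda>n. (\<Sum>k<n. f ((T ^^ k) x)) / n) \<longlonglongrightarrow> expectation f"
proof -
  have upper: "AE x in M. \<forall>j. eventually (\<lambda>n. (\<Sum>k<n. g ((T ^^ k) x)) / n < expectation g + 2 / Suc j) sequentially"
    if g: "integrable M g" for g :: "'a \<Rightarrow> real"
  proof (subst AE_all_countable, rule allI)
    fix j
    \<comment> \<open>Half of the tolerance gives \<open>g - c\<close> the mean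
      \<open>- 1 / Suc j < 0\<close>, so its sums are bounded above; the other half absorbs
      \<open>K / n\<close>. The two-sided limit comes from \<open>g = f\<close> and
      \<open>g = - f\<close>.\<close>
    define c where "c = expectation g + 1 / Suc j"
    have "AE x in M. bdd_above (range (\<lambda>n. \<Sum>k<n. g ((T ^^ k) x) - c))"
      by (rule birkhoff_sums_bdd_above[OF T inv erg]) (use g in \<open>auto simp: c_def prob_space\<close>)
    then show "AE x in M. eventually (\<lambda>n. (\<Sum>k<n. g ((T ^^ k) x)) / n < expectation g + 2 / Suc j) sequentially"
    proof (rule AE_mp, intro AE_I2 impI)
      fix x assume "bdd_above (range (\<lambda>n. \<Sum>k<n. g ((T ^^ k) x) - c))"
      then obtain K where K: "\<And>n. (\<Sum>k<n. g ((T ^^ k) x) - c) \<le> K" by (auto simp: bdd_above_def)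
      have "(\<lambda>n. K / real n) \<longlonglongrightarrow> 0" by (rule lim_const_over_n)
      then have "eventually (\<lambda>n. K / real n < 1 / Suc j) sequentially"
        by (rule order_tendstoD) simp
      then show "eventually (\<lambda>n. (\<Sum>k<n. g ((T ^^ k) x)) / n < expectation g + 2 / Suc j) sequentially"
        using eventually_gt_at_top[of 0]
      proof eventually_elim
        case (elim n)
        have "(\<Sum>k<n. g ((T ^^ k) x)) \<le> K + n * c"
          using K[of n] by (simp add: sum_subtractf)
        then have "(\<Sum>k<n. g ((T ^^ k) x)) / n \<le> K / n + c"
          using elim by (simp add: field_simps)
        then show ?case using elim by (simp add: c_def)
      qed
    qed
  qed
  from upper[OF f] upper[OF integrable_minus[OF f]] show ?thesis
  proof eventually_elim
    case (elim x)
    show ?case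
    proof (rule LIMSEQ_I)
      fix r :: real assume "0 < r"
      then obtain j where j: "2 / Suc j < r"
        using reals_Archimedean[of "r / 2"] by (auto simp: field_simps)
      have "eventually (\<lambda>n. norm ((\<Sum>k<n. f ((T ^^ k) x)) / n - expectation f) < r) sequentially"
        using elim(1)[rule_format, of j] elim(2)[rule_format, of j]
        by eventually_elim (use j in \<open>auto simp: sum_negf abs_less_iff\<close>)
      then show "\<exists>no. \<forall>n\<ge>no. norm ((\<Sum>k<n. f ((T ^^ k) x)) / n - expectation f) < r"
        by (simp add: eventually_sequentially)
    qed
  qed
qed

end

section \<open>The martingale central limit theorem\<close>

text \<open>The logarithm of \<open>1 + \<i> * y\<close> is \<open>\<i> * y + y\<^sup>2 / 2\<close>
  up to third order, and the Gaussian factor cancels the quadratic term.\<close>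

lemma iexp_approx_gaussian:
  fixes y :: real
  assumes y: "\<bar>y\<bar> \<le> 1"
  shows "cmod (iexp y - (1 + \<i> * y) * of_real (exp (- y\<^sup>2 / 2))) \<le> \<bar>y\<bar> ^ 3"
proof -
  define r where "r = exp (- y\<^sup>2 / 2) - (1 - y\<^sup>2 / 2)"
  have r: "\<bar>r\<bar> \<le> y ^ 4 / 8"
  proof -
    have "0 \<le> r" unfolding r_def using exp_ge_add_one_self[of "- y\<^sup>2 / 2"] by simp
    moreover have "r \<le> y ^ 4 / 8"
    proof -
      \<comment> \<open>The two quadratics in \<open>z\<close> multiply to
        \<open>1 + z ^ 4 / 4\<close>, so the lower Taylor bound for \<open>exp z\<close> becomes an
        upper bound for \<open>exp (- z)\<close>.\<close>
      define z where "z = y\<^sup>2 / 2"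
      have z: "0 \<le> z" by (simp add: z_def)
      have "(1 - z + z\<^sup>2 / 2) * (1 + z + z\<^sup>2 / 2) \<ge> 1"
        using z by (simp add: power2_eq_square algebra_simps)
      moreover have "1 + z + z\<^sup>2 / 2 \<le> exp z" using exp_lower_Taylor_quadratic[OF z] .
      moreover have "0 < 1 - z + z\<^sup>2 / 2"
        using zero_le_power2[of "1 - z"] unfolding power2_diff by simp
      ultimately have "(1 - z + z\<^sup>2 / 2) * exp z \<ge> 1"
        by (smt (verit, best) mult_left_mono)
      then have "exp (- z) \<le> 1 - z + z\<^sup>2 / 2"
        by (simp add: exp_minus field_simps)
      then show ?thesis
        unfolding r_def z_def by (simp add: field_simps power_divide flip: power_mult)
    qed
    ultimately show ?thesis by simp
  qed
  have *: "iexp y - (1 + \<i> * y) * of_real (exp (- y\<^sup>2 / 2)) =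
      (iexp y - (\<Sum>k\<le>2. (\<i> * y)^k / fact k)) + (\<i> * y ^ 3 / 2 - (1 + \<i> * y) * r)"
    by (simp add: r_def numeral_2_eq_2 eval_nat_numeral field_simps)
  have "cmod (iexp y - (1 + \<i> * y) * of_real (exp (- y\<^sup>2 / 2))) \<le>
      cmod (iexp y - (\<Sum>k\<le>2. (\<i> * y)^k / fact k)) + (cmod (\<i> * y ^ 3 / 2) + cmod (1 + \<i> * y) * cmod (of_real r))"
    unfolding * by (rule order_trans[OF norm_triangle_ineq add_left_mono]) (metis norm_mult norm_triangle_ineq4)
  \<comment> \<open>The Taylor remainder contributes \<open>1 / 6\<close>, the cross term of
    \<open>\<i> * y\<close> with \<open>- y\<^sup>2 / 2\<close> contributes \<open>1 / 2\<close>,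
    and the quartic error \<open>r\<close> contributes \<open>2 / 8\<close>; the total is
    \<open>11 / 12\<close>.\<close>
  also have "\<dots> \<le> \<bar>y\<bar> ^ 3 / 6 + (\<bar>y\<bar> ^ 3 / 2 + 2 * (\<bar>y\<bar> ^ 3 / 8))"
  proof (intro add_mono mult_mono)
    show "cmod (iexp y - (\<Sum>k\<le>2. (\<i> * y)^k / fact k)) \<le> \<bar>y\<bar> ^ 3 / 6"
      using iexp_approx1[of y 2] by (simp add: eval_nat_numeral)
    show "cmod (1 + \<i> * y) \<le> 2"
      using norm_triangle_ineq[of 1 "\<i> * y"] y by (simp add: norm_mult)
    have "\<bar>y\<bar> ^ 4 \<le> \<bar>y\<bar> ^ 3" by (rule power_decreasing) (use y in auto)
    then show "cmod (of_real r) \<le> \<bar>y\<bar> ^ 3 / 8" using r by simp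
  qed (auto simp: norm_mult norm_power norm_divide)
  also have "\<dots> \<le> \<bar>y\<bar> ^ 3" by simp
  finally show ?thesis .
qed

text \<open>Convergence of the averages forces \<open>a n / n\<close> to vanish; late indices then
  satisfy \<open>a t \<le> r * t\<close>, and the finitely many early ones stay below a fixed
  number. For squared increments this is the negligibility of the largest one, obtained path by
  path.\<close>

lemma max_increment_negligible:
  fixes a :: "nat \<Rightarrow> real" and r :: real
  assumes nonneg: "\<And>t. 0 \<le> a t" and lim: "(\<lambda>n. (\<Sum>t<n. a t) / n) \<longlonglongrightarrow> s" and r: "0 < r"
  shows "eventually (\<lambda>n. \<forall>t<n. a t \<le> r * n) sequentially"
proof -
  define V where "V n = (\<Sum>t<n. a t)" for n
  have "(\<lambda>n. (V (Suc n) / Suc n) * (Suc n / n) - V n / n) \<longlonglongrightarrow> s * 1 - s"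
    by (intro tendsto_intros LIMSEQ_Suc[of "\<lambda>n. V n / n"] LIMSEQ_Suc_n_over_n lim[folded V_def])
  moreover have "eventually (\<lambda>n. (V (Suc n) / Suc n) * (Suc n / n) - V n / n = a n / n) sequentially"
    using eventually_gt_at_top[of 0]
    by eventually_elim (simp add: V_def divide_simps del: of_nat_Suc)
  ultimately have "(\<lambda>n. a n / n) \<longlonglongrightarrow> 0"
    by (simp add: tendsto_cong)
  then have "eventually (\<lambda>n. a n / n < r) sequentially" by (rule order_tendstoD) (rule r)
  then have "eventually (\<lambda>n. n > 0 \<and> a n / n < r) sequentially"
    using eventually_gt_at_top[of 0] by eventually_elim auto
  then obtain N where N: "\<And>n. n \<ge> N \<Longrightarrow> n > 0 \<and> a n / n < r"
    by (auto simp: eventually_sequentially)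
  have "eventually (\<lambda>n. real n \<ge> V N / r) sequentially"
    using filterlim_real_sequentially by (auto simp: filterlim_at_top)
  then show ?thesis
  proof eventually_elim
    case (elim n)
    show ?case
    proof (intro allI impI)
      fix t assume "t < n"
      show "a t \<le> r * n"
      proof (cases "t < N")
        case True
        then have "a t \<le> V N" unfolding V_def by (intro member_le_sum) (auto simp: nonneg)
        also have "\<dots> \<le> r * n" using elim r by (simp add: field_simps)
        finally show ?thesis .
      next
        case False
        then have "0 < t" "a t / t < r" using N[of t] by auto
        then have "a t \<le> r * t" by (simp add: divide_less_eq)
        also have "\<dots> \<le> r * n" using \<open>t < n\<close> r by simp
        finally show ?thesis .
      qed
    qed
  qed
qed

lemma cmod_one_plus_imaginary: "(cmod (1 + \<i> * of_real y))\<^sup>2 = 1 + y\<^sup>2"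
  by (simp add: cmod_power2)

text \<open>A statement about a single path. Both products have factors of modulus at most one, so
  they differ by at most the sum of the cubic errors, which is bounded by the largest increment
  times the quadratic variation. The Gaussian factor is first taken with the actual quadratic
  variation \<open>Q n\<close>, so that it distributes over the product, and only then replaced by
  its limit.\<close>

lemma mcleish_product_limit:
  fixes x :: "nat \<Rightarrow> real" and u s :: real
  assumes lim: "(\<lambda>n. (\<Sum>t<n. (x t)\<^sup>2) / n) \<longlonglongrightarrow> s"
  shows "(\<lambda>n. iexp (u * ((\<Sum>t<n. x t) / sqrt n)) -
      (\<Prod>t<n. 1 + \<i> * of_real (u / sqrt n * x t)) * of_real (exp (- u\<^sup>2 * s / 2))) \<longlonglongrightarrow> 0"
proof -
  define y where "y n t = u / sqrt n * x t" for n :: nat and t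
  define Q where "Q n = u\<^sup>2 * ((\<Sum>t<n. (x t)\<^sup>2) / n)" for n
  define P where "P n = (\<Prod>t<n. 1 + \<i> * of_real (y n t))" for n
  have Q: "(\<Sum>t<n. (y n t)\<^sup>2) = Q n" for n
    by (simp add: y_def Q_def power_mult_distrib power_divide sum_distrib_left sum_divide_distrib)
  have Q_lim: "Q \<longlonglongrightarrow> u\<^sup>2 * s" unfolding Q_def by (intro tendsto_intros lim)
  have small: "eventually (\<lambda>n. \<forall>t<n. \<bar>y n t\<bar> \<le> r) sequentially" if r: "0 < r" for r
  proof -
    \<comment> \<open>The summand \<open>1\<close> keeps the denominator positive when
      \<open>u = 0\<close>.\<close>
    define c where "c = r\<^sup>2 / (u\<^sup>2 + 1)"
    have "0 < c" unfolding c_def using r by (simp add: add_nonneg_pos)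
    from max_increment_negligible[OF _ lim this]
    have "eventually (\<lambda>n. \<forall>t<n. (x t)\<^sup>2 \<le> c * n) sequentially" by simp
    then show ?thesis
    proof eventually_elim
      case (elim n)
      show ?case
      proof (intro allI impI)
        fix t assume t: "t < n"
        have "(y n t)\<^sup>2 = u\<^sup>2 * (x t)\<^sup>2 / n" by (simp add: y_def power_mult_distrib power_divide)
        also have "\<dots> \<le> u\<^sup>2 * (c * n) / n"
          using elim t by (intro divide_right_mono mult_left_mono) auto
        also have "\<dots> = u\<^sup>2 * c" using t by simp
        also have "\<dots> \<le> (u\<^sup>2 + 1) * c" using \<open>0 < c\<close> by simp
        also have "\<dots> = r\<^sup>2" unfolding c_def by (simp add: add_nonneg_eq_0_iff)
        finally show "\<bar>y n t\<bar> \<le> r" using r abs_le_square_iff[of "y n t" r] by simp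
      qed
    qed
  qed
  have iexp_prod: "iexp (u * ((\<Sum>t<n. x t) / sqrt n)) = (\<Prod>t<n. iexp (y n t))" for n
    by (simp add: y_def exp_sum[symmetric] sum_distrib_left sum_divide_distrib)
  have gauss_prod: "P n * of_real (exp (- Q n / 2)) =
      (\<Prod>t<n. (1 + \<i> * of_real (y n t)) * of_real (exp (- (y n t)\<^sup>2 / 2)))" for n
    by (simp add: P_def prod.distrib Q[symmetric] sum_negf[symmetric] sum_divide_distrib exp_sum
        flip: of_real_prod)
  have P_bound: "cmod (P n) \<le> exp (Q n / 2)" for n
  proof -
    have "cmod (1 + \<i> * of_real (y n t)) \<le> exp ((y n t)\<^sup>2 / 2)" for t
    proof (rule power2_le_imp_le)
      show "(cmod (1 + \<i> * of_real (y n t)))\<^sup>2 \<le> (exp ((y n t)\<^sup>2 / 2))\<^sup>2"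
        unfolding cmod_one_plus_imaginary
        by (simp add: exp_double[symmetric])
    qed simp
    then have "cmod (P n) \<le> (\<Prod>t<n. exp ((y n t)\<^sup>2 / 2))"
      unfolding P_def prod_norm[symmetric] by (intro prod_mono) auto
    then show ?thesis by (simp add: exp_sum[symmetric] Q[symmetric] sum_divide_distrib)
  qed
  have "(\<lambda>n. (\<Prod>t<n. iexp (y n t)) - P n * of_real (exp (- Q n / 2))) \<longlonglongrightarrow> 0"
  proof (rule LIMSEQ_I)
    fix r :: real assume r: "0 < r"
    \<comment> \<open>\<open>K\<close> lies above the limit of \<open>Q\<close> and is positive
      whatever the sign of \<open>s\<close>; \<open>d \<le> 1\<close> is required by the cubic
      estimate, and \<open>d * K \<le> r / 2\<close> leaves a strict margin.\<close>
    define K where "K = u\<^sup>2 * \<bar>s\<bar> + 1"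
    define d where "d = min 1 (r / 2 / K)"
    have K: "0 < K" by (simp add: K_def add_nonneg_pos)
    have "d * K \<le> r / 2 / K * K"
      using K by (intro mult_right_mono) (auto simp: d_def)
    then have d: "0 < d" "d \<le> 1" "d * K \<le> r / 2"
      using r K by (simp_all add: d_def)
    have "u\<^sup>2 * s \<le> u\<^sup>2 * \<bar>s\<bar>" by (intro mult_left_mono) auto
    then have "eventually (\<lambda>n. Q n < K) sequentially"
      by (intro order_tendstoD(2)[OF Q_lim]) (simp add: K_def)
    from this small[OF d(1)]
    have "eventually (\<lambda>n. norm ((\<Prod>t<n. iexp (y n t)) - P n * of_real (exp (- Q n / 2)) - 0) < r) sequentially"
    proof eventually_elim
      case (elim n)
      have "norm ((\<Prod>t<n. iexp (y n t)) - P n * of_real (exp (- Q n / 2))) \<le>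
          (\<Sum>t<n. norm (iexp (y n t) - (1 + \<i> * of_real (y n t)) * of_real (exp (- (y n t)\<^sup>2 / 2))))"
        unfolding gauss_prod
      proof (rule norm_prod_diff)
        fix t
        have "cmod ((1 + \<i> * of_real (y n t)) * of_real (exp (- (y n t)\<^sup>2 / 2))) \<le> 1"
        proof (rule power2_le_imp_le)
          have "(1 + (y n t)\<^sup>2) * exp (- (y n t)\<^sup>2) \<le> exp ((y n t)\<^sup>2) * exp (- (y n t)\<^sup>2)"
            by (intro mult_right_mono) auto
          also have "\<dots> = 1" by (simp add: exp_minus)
          finally show "(cmod ((1 + \<i> * of_real (y n t)) * of_real (exp (- (y n t)\<^sup>2 / 2))))\<^sup>2 \<le> 1\<^sup>2"
            unfolding norm_mult power_mult_distrib cmod_one_plus_imaginary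
            by (simp add: exp_double[symmetric])
        qed simp
        then show "norm ((1 + \<i> * of_real (y n t)) * complex_of_real (exp (- (y n t)\<^sup>2 / 2))) \<le> 1" .
      qed simp
      also have "\<dots> \<le> (\<Sum>t<n. d * (y n t)\<^sup>2)"
      proof (rule sum_mono)
        fix t assume "t \<in> {..<n}"
        then have yd: "\<bar>y n t\<bar> \<le> d" using elim by simp
        then have "norm (iexp (y n t) - (1 + \<i> * of_real (y n t)) * of_real (exp (- (y n t)\<^sup>2 / 2))) \<le> \<bar>y n t\<bar> ^ 3"
          using d by (intro iexp_approx_gaussian) auto
        also have "\<dots> = \<bar>y n t\<bar> * (y n t)\<^sup>2" by (simp add: eval_nat_numeral)
        also have "\<dots> \<le> d * (y n t)\<^sup>2" using yd by (rule mult_right_mono) simp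
        finally show "norm (iexp (y n t) - (1 + \<i> * of_real (y n t)) * of_real (exp (- (y n t)\<^sup>2 / 2))) \<le> d * (y n t)\<^sup>2" .
      qed
      also have "\<dots> = d * Q n" by (simp add: Q[symmetric] sum_distrib_left)
      also have "\<dots> \<le> d * K" using elim d by (intro mult_left_mono) auto
      also have "\<dots> < r" using d r by linarith
      finally show ?case by simp
    qed
    then show "\<exists>no. \<forall>n\<ge>no. norm ((\<Prod>t<n. iexp (y n t)) - P n * of_real (exp (- Q n / 2)) - 0) < r"
      by (simp add: eventually_sequentially)
  qed
  \<comment> \<open>The difference of the two Gaussian factors tends to zero, while
    \<open>P n\<close> stays bounded because \<open>Q\<close> converges.\<close>
  moreover have "(\<lambda>n. P n * (of_real (exp (- Q n / 2)) - of_real (exp (- (u\<^sup>2 * s) / 2)))) \<longlonglongrightarrow> 0"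
  proof (rule Lim_null_comparison)
    show "eventually (\<lambda>n. norm (P n * (of_real (exp (- Q n / 2)) - of_real (exp (- (u\<^sup>2 * s) / 2)))) \<le>
        exp (Q n / 2) * \<bar>exp (- Q n / 2) - exp (- (u\<^sup>2 * s) / 2)\<bar>) sequentially"
      unfolding norm_mult of_real_diff[symmetric] norm_of_real
      by (intro always_eventually allI mult_right_mono P_bound) simp
    have "(\<lambda>n. exp (Q n / 2) * \<bar>exp (- Q n / 2) - exp (- (u\<^sup>2 * s) / 2)\<bar>) \<longlonglongrightarrow>
        exp (u\<^sup>2 * s / 2) * \<bar>exp (- (u\<^sup>2 * s) / 2) - exp (- (u\<^sup>2 * s) / 2)\<bar>"
      by (intro tendsto_intros Q_lim) auto
    then show "(\<lambda>n. exp (Q n / 2) * \<bar>exp (- Q n / 2) - exp (- (u\<^sup>2 * s) / 2)\<bar>) \<longlonglongrightarrow> 0" by simp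
  qed
  ultimately have "(\<lambda>n. ((\<Prod>t<n. iexp (y n t)) - P n * of_real (exp (- Q n / 2))) +
      P n * (of_real (exp (- Q n / 2)) - of_real (exp (- (u\<^sup>2 * s) / 2)))) \<longlonglongrightarrow> 0 + 0"
    by (rule tendsto_add)
  then show ?thesis
    unfolding iexp_prod by (simp add: algebra_simps P_def y_def)
qed

section \<open>Normal laws and their characteristic functions\<close>

lemma real_distribution_normal_law:
  assumes "0 \<le> v" shows "real_distribution (normal_law a v)"
proof (cases "v = 0")
  case True
  interpret R: prob_space "return borel a" by (rule prob_space_return) simp
  show ?thesis by (simp add: normal_law_def True real_distribution_def real_distribution_axioms_def R.prob_space_axioms)
next
  case False
  then have "prob_space (density lborel (normal_density a (sqrt v)))"
    using assms by (intro prob_space_normal_density) simp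
  then show ?thesis
    using False by (simp add: normal_law_def real_distribution_def real_distribution_axioms_def)
qed

text \<open>Rescaling by \<open>sqrt v\<close> reduces the case \<open>v > 0\<close> to the standard
  normal law. The point mass at \<open>v = 0\<close> obeys the same formula, so the limit theorem
  has no separate degenerate case.\<close>

lemma char_normal_law:
  assumes v: "0 \<le> v"
  shows "char (normal_law 0 v) u = of_real (exp (- u\<^sup>2 * v / 2))"
proof (cases "v = 0")
  case True
  then show ?thesis by (simp add: normal_law_def char_def integral_return)
next
  case False
  then have v: "0 < v" using v by simp
  interpret N: prob_space "density lborel (\<lambda>x. ennreal (normal_density 0 (sqrt v) x))"
    by (rule prob_space_normal_density) (use v in simp)
  have "distributed (normal_law 0 v) lborel (\<lambda>x. x) (normal_density 0 (sqrt v))"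
    using v by (auto simp: distributed_def normal_law_def distr_id2)
  then have *: "distributed (normal_law 0 v) lborel (\<lambda>x. x / sqrt v) std_normal_density"
    using N.normal_standard_normal_convert[of "sqrt v" "\<lambda>x. x" 0] v
    by (simp add: normal_law_def)
  have sn: "std_normal_distribution = distr (normal_law 0 v) lborel (\<lambda>x. x / sqrt v)"
    using * by (simp add: distributed_def)
  have "char (normal_law 0 v) u = (CLINT x|normal_law 0 v. iexp (u * sqrt v * (x / sqrt v)))"
    using v by (simp add: char_def)
  also have "\<dots> = char std_normal_distribution (u * sqrt v)"
    unfolding sn char_def
    by (subst integral_distr) (use v in \<open>auto simp: normal_law_def\<close>)
  also have "\<dots> = of_real (exp (- u\<^sup>2 * v / 2))"
    using v by (simp add: char_std_normal_distribution power_mult_distrib)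
  finally show ?thesis .
qed

section \<open>Convergence of expectations under an L2 bound\<close>

context prob_space
begin

text \<open>An L2 bound gives uniform integrability: the excess of \<open>D n\<close> over a level
  \<open>L\<close> costs at most \<open>K / L\<close>, and the part capped at \<open>L\<close> is
  handled by bounded convergence.\<close>

lemma expectation_tendsto_0_if_L2_bounded:
  fixes D :: "nat \<Rightarrow> 'a \<Rightarrow> complex"
  assumes meas [measurable]: "\<And>n. D n \<in> borel_measurable M"
    and conv: "AE x in M. (\<lambda>n. D n x) \<longlonglongrightarrow> 0"
    and int: "\<And>n. integrable M (\<lambda>x. (cmod (D n x))\<^sup>2)"
    and bound: "\<And>n. expectation (\<lambda>x. (cmod (D n x))\<^sup>2) \<le> K"
  shows "(\<lambda>n. expectation (D n)) \<longlonglongrightarrow> 0"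
proof (rule LIMSEQ_I)
  fix r :: real assume r: "0 < r"
  have K: "0 \<le> K" using order_trans[OF integral_nonneg_AE bound] by simp
  \<comment> \<open>Chosen so that \<open>K / L < r / 2\<close>; \<open>K + 1\<close> instead of
    \<open>K\<close> keeps \<open>L\<close> positive.\<close>
  define L where "L = 2 * (K + 1) / r"
  have L: "0 < L" "K / L < r / 2" unfolding L_def using K r by (auto simp: field_simps)
  have min_int: "integrable M (\<lambda>x. min (cmod (D n x)) L)" for n
    by (rule integrable_const_bound[of _ L]) (use L in auto)
  have "(\<lambda>n. expectation (\<lambda>x. min (cmod (D n x)) L)) \<longlonglongrightarrow> expectation (\<lambda>x. 0)"
  proof (rule integral_dominated_convergence[where w="\<lambda>_. L"])
    show "AE x in M. (\<lambda>n. min (cmod (D n x)) L) \<longlonglongrightarrow> 0"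
      using conv
    proof eventually_elim
      case (elim x)
      have "(\<lambda>n. min (cmod (D n x)) L) \<longlonglongrightarrow> min (cmod 0) L"
        by (intro tendsto_intros elim)
      then show ?case using L by simp
    qed
  qed (use L in auto)
  then have "eventually (\<lambda>n. expectation (\<lambda>x. min (cmod (D n x)) L) < r / 2) sequentially"
    by (rule order_tendstoD) (use r in simp)
  then have "eventually (\<lambda>n. norm (expectation (D n) - 0) < r) sequentially"
  proof eventually_elim
    case (elim n)
    have le: "cmod (D n x) \<le> min (cmod (D n x)) L + (cmod (D n x))\<^sup>2 / L" for x
    proof (cases "cmod (D n x) \<le> L")
      case False
      then have "cmod (D n x) * L \<le> (cmod (D n x))\<^sup>2"
        unfolding power2_eq_square by (intro mult_left_mono) auto
      then have "cmod (D n x) \<le> (cmod (D n x))\<^sup>2 / L" using L by (simp add: pos_le_divide_eq)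
      then show ?thesis using L False by (simp add: min_def)
    qed (use L in \<open>simp add: min_def\<close>)
    have "norm (expectation (D n)) \<le> expectation (\<lambda>x. cmod (D n x))"
      by (rule integral_norm_bound)
    also have "\<dots> \<le> expectation (\<lambda>x. min (cmod (D n x)) L + (cmod (D n x))\<^sup>2 / L)"
    proof (rule integral_mono)
      show rhs: "integrable M (\<lambda>x. min (cmod (D n x)) L + (cmod (D n x))\<^sup>2 / L)"
        using min_int int by auto
      show "integrable M (\<lambda>x. cmod (D n x))"
        by (rule Bochner_Integration.integrable_bound[OF rhs])
           (use le in \<open>auto intro!: AE_I2 order_trans[OF le abs_ge_self]\<close>)
    qed (rule le)
    also have "\<dots> = expectation (\<lambda>x. min (cmod (D n x)) L) + expectation (\<lambda>x. (cmod (D n x))\<^sup>2) / L"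
      using min_int int by simp
    also have "\<dots> \<le> expectation (\<lambda>x. min (cmod (D n x)) L) + K / L"
      using L bound by (intro add_left_mono divide_right_mono) auto
    also have "\<dots> < r" using elim L(2) by linarith
    finally show ?case by simp
  qed
  then show "\<exists>no. \<forall>n\<ge>no. norm (expectation (D n) - 0) < r"
    by (simp add: eventually_sequentially)
qed

lemma integrable_mult_square_integrable:
  fixes f g :: "'a \<Rightarrow> real"
  assumes [measurable]: "f \<in> borel_measurable M" "g \<in> borel_measurable M"
    and f: "integrable M (\<lambda>x. (f x)\<^sup>2)" and g: "integrable M (\<lambda>x. (g x)\<^sup>2)"
  shows "integrable M (\<lambda>x. f x * g x)"
proof (rule Bochner_Integration.integrable_bound[of _ "\<lambda>x. (f x)\<^sup>2 + (g x)\<^sup>2"])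
  have "\<bar>a * b\<bar> \<le> a\<^sup>2 + b\<^sup>2" for a b :: real
    using zero_le_power2[of "\<bar>a\<bar> - \<bar>b\<bar>"] zero_le_power2[of a] zero_le_power2[of b]
    unfolding power2_diff abs_mult power2_abs
    using mult_nonneg_nonneg[OF abs_ge_zero[of a] abs_ge_zero[of b]] by linarith
  then show "AE x in M. norm (f x * g x) \<le> norm ((f x)\<^sup>2 + (g x)\<^sup>2)"
    by (auto intro!: AE_I2 order_trans[OF _ abs_ge_self])
qed (use f g in auto)

end

text \<open>Stopping the product as soon as the quadratic variation exceeds \<open>L\<close> keeps it bounded in
  \<open>L\<^sup>2\<close>: all factors but the last nontrivial one are controlled by \<open>exp (c\<^sup>2 L)\<close>.\<close>

lemma truncated_product_bound:
  fixes x :: "nat \<Rightarrow> real"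
  assumes L: "0 \<le> L"
  shows "(cmod (\<Prod>t<n. 1 + \<i> * of_real (c * (of_bool ((\<Sum>j<t. (x j)\<^sup>2) \<le> L) * x t))))\<^sup>2 \<le>
    exp (c\<^sup>2 * L) * (1 + c\<^sup>2 * (\<Sum>t<n. (x t)\<^sup>2))"
proof -
  define V where "V t = (\<Sum>j<t. (x j)\<^sup>2)" for t
  define P where "P n = (\<Prod>t<n. 1 + \<i> * of_real (c * (of_bool (V t \<le> L) * x t)))" for n
  have V_mono: "V t \<le> V (Suc t)" for t by (simp add: V_def)
  have P_Suc: "(cmod (P (Suc n)))\<^sup>2 = (cmod (P n))\<^sup>2 * (1 + c\<^sup>2 * (of_bool (V n \<le> L) * (x n)\<^sup>2))" for n
    unfolding P_def prod.lessThan_Suc norm_mult power_mult_distrib cmod_one_plus_imaginary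
    by (simp add: power_mult_distrib)
  \<comment> \<open>The exponential bound holds until the truncation sets in. At the crossing step
    \<open>V n \<le> L\<close> is still true, so it controls all earlier factors and only
    \<open>1 + c\<^sup>2 * (x n)\<^sup>2\<close> remains; afterwards every factor is
    \<open>1\<close>.\<close>
  have "(V n \<le> L \<longrightarrow> (cmod (P n))\<^sup>2 \<le> exp (c\<^sup>2 * V n)) \<and>
      (cmod (P n))\<^sup>2 \<le> exp (c\<^sup>2 * L) * (1 + c\<^sup>2 * V n)"
  proof (induction n)
    case 0
    then show ?case using L by (simp add: P_def V_def)
  next
    case (Suc n)
    have V_Suc: "V (Suc n) = V n + (x n)\<^sup>2" by (simp add: V_def)
    have V_nonneg: "0 \<le> V n" by (simp add: V_def sum_nonneg)
    show ?case
    proof (cases "V n \<le> L")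
      case True
      then have P: "(cmod (P n))\<^sup>2 \<le> exp (c\<^sup>2 * V n)" using Suc by simp
      have "(cmod (P (Suc n)))\<^sup>2 \<le> exp (c\<^sup>2 * V n) * exp (c\<^sup>2 * (x n)\<^sup>2)"
        unfolding P_Suc using True P by (intro mult_mono) auto
      then have "(cmod (P (Suc n)))\<^sup>2 \<le> exp (c\<^sup>2 * V (Suc n))"
        by (simp add: V_Suc distrib_left exp_add)
      moreover have "(cmod (P (Suc n)))\<^sup>2 \<le> exp (c\<^sup>2 * L) * (1 + c\<^sup>2 * V (Suc n))"
      proof -
        have "exp (c\<^sup>2 * V n) \<le> exp (c\<^sup>2 * L)" using True by (simp add: mult_left_mono)
        with P have "(cmod (P n))\<^sup>2 \<le> exp (c\<^sup>2 * L)" by (rule order_trans)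
        then show ?thesis
          unfolding P_Suc using True V_nonneg
          by (intro mult_mono) (auto simp: V_Suc distrib_left)
      qed
      ultimately show ?thesis by simp
    next
      case False
      have "(cmod (P n))\<^sup>2 \<le> exp (c\<^sup>2 * L) * (1 + c\<^sup>2 * V n)" using Suc by simp
      also have "\<dots> \<le> exp (c\<^sup>2 * L) * (1 + c\<^sup>2 * V (Suc n))"
        by (intro mult_left_mono add_left_mono V_mono) auto
      finally have "(cmod (P n))\<^sup>2 \<le> exp (c\<^sup>2 * L) * (1 + c\<^sup>2 * V (Suc n))" .
      then show ?thesis using False V_mono[of n] by (auto simp: P_Suc)
    qed
  qed
  then show ?thesis unfolding P_def V_def by blast
qed

text \<open>\<open>F t\<close> stands for the information strictly before time \<open>t\<close>:
  \<open>e t\<close> is centred given \<open>F t\<close>, and an \<open>F t\<close>-measurable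
  weight is predictable.\<close>

locale martingale_differences = prob_space M
  for M :: "'a measure" and F :: "nat \<Rightarrow> 'a measure" and e :: "nat \<Rightarrow> 'a \<Rightarrow> real" +
  assumes subalg: "\<And>t. subalgebra M (F t)"
    and adapted: "\<And>s t. s < t \<Longrightarrow> e s \<in> borel_measurable (F t)"
    and square_integrable: "\<And>t. integrable M (\<lambda>x. (e t x)\<^sup>2)"
    and cond_exp_0: "\<And>t. AE x in M. real_cond_exp M (F t) (e t) x = 0"
begin

lemma measurable_e [measurable]: "e t \<in> borel_measurable M"
  using measurable_from_subalg[OF subalg adapted[of t "Suc t"]] by simp

text \<open>Square integrability of the weight makes the product integrable, as is required for
  pulling \<open>g\<close> out of the conditional expectation.\<close>

lemma expectation_predictable_mult:
  assumes g: "g \<in> borel_measurable (F t)" and g2: "integrable M (\<lambda>x. (g x)\<^sup>2)"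
  shows "integrable M (\<lambda>x. g x * e t x)" "expectation (\<lambda>x. g x * e t x) = 0"
proof -
  interpret finite_measure_subalgebra M "F t"
    by unfold_locales (rule subalg)
  have [measurable]: "g \<in> borel_measurable M" using measurable_from_subalg[OF subalg g] .
  show int: "integrable M (\<lambda>x. g x * e t x)"
    by (intro integrable_mult_square_integrable g2 square_integrable) auto
  have "expectation (\<lambda>x. g x * e t x) = expectation (\<lambda>x. g x * real_cond_exp M (F t) (e t) x)"
    by (rule real_cond_exp_intg(2)[symmetric, OF int g]) simp
  also have "\<dots> = expectation (\<lambda>x. 0)"
    by (rule integral_cong_AE) (use cond_exp_0[of t] in auto)
  finally show "expectation (\<lambda>x. g x * e t x) = 0" by simp
qed

definition truncated_product :: "real \<Rightarrow> real \<Rightarrow> nat \<Rightarrow> 'a \<Rightarrow> complex" where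
  "truncated_product c L n x =
     (\<Prod>t<n. 1 + \<i> * of_real (c * (of_bool ((\<Sum>j<t. (e j x)\<^sup>2) \<le> L) * e t x)))"

lemma truncated_product_adapted: "truncated_product c L n \<in> borel_measurable (F n)"
proof -
  have [measurable]: "e t \<in> borel_measurable (F n)" if "t < n" for t using adapted[OF that] .
  have "(\<lambda>x. 1 + \<i> * of_real (c * (of_bool ((\<Sum>j<t. (e j x)\<^sup>2) \<le> L) * e t x)))
      \<in> borel_measurable (F n)" if t: "t < n" for t
  proof -
    have [measurable]: "(\<lambda>x. \<Sum>j<t. (e j x)\<^sup>2) \<in> borel_measurable (F n)"
      using t by (intro borel_measurable_sum) (auto intro!: borel_measurable_power adapted)
    note [measurable] = adapted[OF t]
    show ?thesis by measurable
  qed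
  then show ?thesis unfolding truncated_product_def by (intro borel_measurable_prod) auto
qed

lemma truncated_product_measurable [measurable]: "truncated_product c L n \<in> borel_measurable M"
  using measurable_from_subalg[OF subalg truncated_product_adapted] .

lemma truncated_product_square_integrable:
  assumes L: "0 \<le> L"
  shows "integrable M (\<lambda>x. (cmod (truncated_product c L n x))\<^sup>2)"
proof (rule Bochner_Integration.integrable_bound)
  show "integrable M (\<lambda>x. exp (c\<^sup>2 * L) * (1 + c\<^sup>2 * (\<Sum>t<n. (e t x)\<^sup>2)))"
    using square_integrable by auto
  show "AE x in M. norm ((cmod (truncated_product c L n x))\<^sup>2) \<le>
      norm (exp (c\<^sup>2 * L) * (1 + c\<^sup>2 * (\<Sum>t<n. (e t x)\<^sup>2)))"
  proof (intro AE_I2)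
    fix x
    have "(cmod (truncated_product c L n x))\<^sup>2 \<le> exp (c\<^sup>2 * L) * (1 + c\<^sup>2 * (\<Sum>t<n. (e t x)\<^sup>2))"
      unfolding truncated_product_def by (rule truncated_product_bound[OF L])
    then show "norm ((cmod (truncated_product c L n x))\<^sup>2) \<le>
        norm (exp (c\<^sup>2 * L) * (1 + c\<^sup>2 * (\<Sum>t<n. (e t x)\<^sup>2)))"
      by (simp add: order_trans[OF _ abs_ge_self])
  qed
qed auto

text \<open>Each new factor adds a predictable square-integrable weight times a martingale
  difference, so the expectation never moves from its initial value. Real and imaginary parts are
  treated apart because conditional expectations are taken of real functions.\<close>

lemma expectation_truncated_product:
  assumes L: "0 \<le> L"
  shows "integrable M (truncated_product c L n)" "expectation (truncated_product c L n) = 1"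
proof -
  let ?P = "truncated_product c L"
  define b where "b t x = (of_bool ((\<Sum>j<t. (e j x)\<^sup>2) \<le> L) :: real)" for t x
  have b_adapted: "b t \<in> borel_measurable (F t)" for t
  proof -
    have [measurable]: "(\<lambda>x. \<Sum>j<t. (e j x)\<^sup>2) \<in> borel_measurable (F t)"
      by (intro borel_measurable_sum) (auto intro!: borel_measurable_power adapted)
    show ?thesis unfolding b_def by measurable
  qed
  \<comment> \<open>\<open>p\<close> stands for \<open>Re\<close> or \<open>Im\<close>; the bound by
    the modulus transfers square integrability from the complex product.\<close>
  have part: "integrable M (\<lambda>x. p (?P t x) * b t x * e t x)"
      "expectation (\<lambda>x. p (?P t x) * b t x * e t x) = 0"
    if p: "p \<in> borel_measurable borel" "\<And>z. \<bar>p z\<bar> \<le> cmod z" for p :: "complex \<Rightarrow> real" and t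
  proof -
    note [measurable] = p(1) b_adapted[of t] truncated_product_adapted[of c L t]
    have m: "(\<lambda>x. p (?P t x) * b t x) \<in> borel_measurable (F t)" by measurable
    have m': "(\<lambda>x. p (?P t x) * b t x) \<in> borel_measurable M"
      using measurable_from_subalg[OF subalg m] .
    have sq: "integrable M (\<lambda>x. (p (?P t x) * b t x)\<^sup>2)"
    proof (rule Bochner_Integration.integrable_bound[OF truncated_product_square_integrable[OF L]])
      have "(p z)\<^sup>2 \<le> (cmod z)\<^sup>2" for z
        using power_mono[OF p(2)[of z], of 2] by simp
      then show "AE x in M. norm ((p (?P t x) * b t x)\<^sup>2) \<le> norm ((cmod (?P t x))\<^sup>2)"
        by (intro AE_I2) (auto simp: b_def power_mult_distrib)
    qed (use m' in measurable)
    show "integrable M (\<lambda>x. p (?P t x) * b t x * e t x)"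
      "expectation (\<lambda>x. p (?P t x) * b t x * e t x) = 0"
      using expectation_predictable_mult[OF m sq] by auto
  qed
  have Re_part: "integrable M (\<lambda>x. Re (?P t x) * b t x * e t x)"
      "expectation (\<lambda>x. Re (?P t x) * b t x * e t x) = 0" for t
    using part[of Re] abs_Re_le_cmod by auto
  have Im_part: "integrable M (\<lambda>x. Im (?P t x) * b t x * e t x)"
      "expectation (\<lambda>x. Im (?P t x) * b t x * e t x) = 0" for t
    using part[of Im] abs_Im_le_cmod by auto
  have step: "Re (?P (Suc t) x) = Re (?P t x) - c * (Im (?P t x) * b t x * e t x)"
      "Im (?P (Suc t) x) = Im (?P t x) + c * (Re (?P t x) * b t x * e t x)" for t x
    by (simp_all add: truncated_product_def b_def)
  have "integrable M (\<lambda>x. Re (?P n x)) \<and> expectation (\<lambda>x. Re (?P n x)) = 1 \<and>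
      integrable M (\<lambda>x. Im (?P n x)) \<and> expectation (\<lambda>x. Im (?P n x)) = 0"
  proof (induction n)
    case 0
    then show ?case by (simp add: truncated_product_def prob_space)
  next
    case (Suc n)
    then show ?case unfolding step using Re_part[of n] Im_part[of n] by simp
  qed
  note * = this
  then have "has_bochner_integral M (\<lambda>x. complex_of_real (Re (?P n x)) + \<i> * complex_of_real (Im (?P n x)))
      (complex_of_real 1 + \<i> * complex_of_real 0)"
    by (intro has_bochner_integral_add has_bochner_integral_mult_right has_bochner_integral_of_real)
       (auto simp: has_bochner_integral_iff)
  then have "has_bochner_integral M (?P n) 1" by (simp flip: complex_eq)
  then show "integrable M (?P n)" "expectation (?P n) = 1"
    by (auto simp: has_bochner_integral_iff)
qed

text \<open>As the truncated product has expectation \<open>1\<close>, the characteristic function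
  differs from the Gaussian one exactly by \<open>expectation (D n)\<close>. This tends to zero
  because \<open>D n\<close> does so almost surely and is bounded in L2.\<close>

theorem martingale_clt:
  assumes bounded: "\<And>t. expectation (\<lambda>x. (e t x)\<^sup>2) \<le> C"
    and quad: "AE x in M. (\<lambda>n. (\<Sum>t<n. (e t x)\<^sup>2) / n) \<longlonglongrightarrow> s"
  shows "weak_conv_m (\<lambda>n. distr M borel (\<lambda>x. (\<Sum>t<n. e t x) / sqrt n)) (normal_law 0 s)"
proof -
  have "AE x in M. 0 \<le> s"
    using quad by eventually_elim (rule LIMSEQ_le_const, auto intro!: divide_nonneg_nonneg sum_nonneg)
  then have s: "0 \<le> s" by simp
  show ?thesis
  proof (rule levy_continuity)
    show "real_distribution (distr M borel (\<lambda>x. (\<Sum>t<n. e t x) / sqrt n))" for n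
      by (intro real_distribution_distr) simp
    show "real_distribution (normal_law 0 s)" by (rule real_distribution_normal_law[OF s])
    fix u :: real
    define Z where "Z n x = iexp (u * ((\<Sum>t<n. e t x) / sqrt n))" for n :: nat and x
    \<comment> \<open>A level proportional to \<open>n\<close> makes
      \<open>c\<^sup>2 * L = u\<^sup>2 * (s + 1)\<close> independent of \<open>n\<close>; the excess
      of \<open>s + 1\<close> over \<open>s\<close> makes the truncation eventually inactive on
      almost every path.\<close>
    define P where "P n = truncated_product (u / sqrt n) ((s + 1) * n) n" for n
    define g where "g = exp (- u\<^sup>2 * s / 2)"
    define D where "D n x = Z n x - P n x * of_real g" for n x
    have L: "0 \<le> (s + 1) * real n" for n using s by simp
    have [measurable]: "Z n \<in> borel_measurable M" "P n \<in> borel_measurable M" for n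
      unfolding Z_def P_def by measurable
    have Z_int: "integrable M (Z n)" for n
      by (rule integrable_const_bound[of _ 1]) (auto simp: Z_def)
    have g: "0 \<le> g" "g \<le> 1" using s by (auto simp: g_def)
    have D_bound: "(cmod (D n x))\<^sup>2 \<le> 2 + 2 * (cmod (P n x))\<^sup>2" for n x
    proof -
      have "cmod (D n x) \<le> cmod (Z n x) + cmod (P n x * of_real g)"
        unfolding D_def by (rule norm_triangle_ineq4)
      also have "\<dots> \<le> 1 + cmod (P n x)"
        using g by (intro add_mono) (auto simp: Z_def norm_mult mult_left_le)
      finally have "(cmod (D n x))\<^sup>2 \<le> (1 + cmod (P n x))\<^sup>2" by (rule power_mono) simp
      then show ?thesis
        using zero_le_power2[of "1 - cmod (P n x)"] unfolding power2_sum power2_diff by simp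
    qed
    have P_sq: "integrable M (\<lambda>x. (cmod (P n x))\<^sup>2)" for n
      unfolding P_def by (rule truncated_product_square_integrable[OF L])
    have P_exp: "expectation (\<lambda>x. (cmod (P n x))\<^sup>2) \<le> exp (u\<^sup>2 * (s + 1)) * (1 + u\<^sup>2 * C)" for n
    \<comment> \<open>At \<open>n = 0\<close> the product is empty; the other case cancels a factor
      \<open>n\<close> against a division by \<open>n\<close>.\<close>
    proof (cases "n = 0")
      case True
      have "0 \<le> C" using order_trans[OF integral_nonneg_AE bounded[of 0]] by simp
      then have "1 * 1 \<le> exp (u\<^sup>2 * (s + 1)) * (1 + u\<^sup>2 * C)" using s by (intro mult_mono) auto
      then show ?thesis using True by (simp add: P_def truncated_product_def prob_space)
    next
      case False
      have c: "(u / sqrt n)\<^sup>2 * ((s + 1) * n) = u\<^sup>2 * (s + 1)"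
        using False by (simp add: power_divide)
      have "expectation (\<lambda>x. (cmod (P n x))\<^sup>2) \<le>
          expectation (\<lambda>x. exp (u\<^sup>2 * (s + 1)) * (1 + (u / sqrt n)\<^sup>2 * (\<Sum>t<n. (e t x)\<^sup>2)))"
      proof (rule integral_mono[OF P_sq])
        show "(cmod (P n x))\<^sup>2 \<le> exp (u\<^sup>2 * (s + 1)) * (1 + (u / sqrt n)\<^sup>2 * (\<Sum>t<n. (e t x)\<^sup>2))" for x
          unfolding P_def truncated_product_def
          using truncated_product_bound[OF L[of n], where c="u / sqrt n" and x="\<lambda>t. e t x" and n=n] unfolding c .
      qed (use square_integrable in auto)
      also have "\<dots> = exp (u\<^sup>2 * (s + 1)) * (1 + (u / sqrt n)\<^sup>2 * (\<Sum>t<n. expectation (\<lambda>x. (e t x)\<^sup>2)))"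
        using square_integrable by (simp add: prob_space)
      also have "\<dots> \<le> exp (u\<^sup>2 * (s + 1)) * (1 + (u / sqrt n)\<^sup>2 * (\<Sum>t<n. C))"
        by (intro mult_left_mono add_left_mono sum_mono bounded) auto
      also have "\<dots> = exp (u\<^sup>2 * (s + 1)) * (1 + u\<^sup>2 * C)"
        using False by (simp add: power_divide)
      finally show ?thesis .
    qed
    have "(\<lambda>n. expectation (D n)) \<longlonglongrightarrow> 0"
    proof (rule expectation_tendsto_0_if_L2_bounded)
      show "D n \<in> borel_measurable M" for n unfolding D_def by measurable
      have rhs: "integrable M (\<lambda>x. 2 + 2 * (cmod (P n x))\<^sup>2)" for n using P_sq by auto
      show D_int: "integrable M (\<lambda>x. (cmod (D n x))\<^sup>2)" for n
        by (rule Bochner_Integration.integrable_bound[OF rhs])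
           (use D_bound in \<open>auto simp: D_def intro!: AE_I2 order_trans[OF _ abs_ge_self]\<close>)
      have "expectation (\<lambda>x. (cmod (D n x))\<^sup>2) \<le> expectation (\<lambda>x. 2 + 2 * (cmod (P n x))\<^sup>2)" for n
        by (rule integral_mono[OF D_int rhs D_bound])
      also have "\<dots> n \<le> 2 + 2 * (exp (u\<^sup>2 * (s + 1)) * (1 + u\<^sup>2 * C))" for n
        using P_sq P_exp[of n] by (simp add: prob_space)
      finally show "expectation (\<lambda>x. (cmod (D n x))\<^sup>2) \<le> 2 + 2 * (exp (u\<^sup>2 * (s + 1)) * (1 + u\<^sup>2 * C))" for n .
      show "AE x in M. (\<lambda>n. D n x) \<longlonglongrightarrow> 0"
        using quad
      proof eventually_elim
        case (elim x)
        have "eventually (\<lambda>n. (\<Sum>t<n. (e t x)\<^sup>2) / n < s + 1) sequentially"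
          by (rule order_tendstoD(2)[OF elim]) simp
        then have "eventually (\<lambda>n. iexp (u * ((\<Sum>t<n. e t x) / sqrt n)) -
            (\<Prod>t<n. 1 + \<i> * of_real (u / sqrt n * e t x)) * of_real (exp (- u\<^sup>2 * s / 2)) = D n x) sequentially"
          using eventually_gt_at_top[of 0]
        proof eventually_elim
          case (elim n)
          have "(\<Sum>j<t. (e j x)\<^sup>2) \<le> (s + 1) * n" if "t < n" for t
          proof -
            have "(\<Sum>j<t. (e j x)\<^sup>2) \<le> (\<Sum>j<n. (e j x)\<^sup>2)"
              by (rule sum_mono2) (use that in auto)
            also have "\<dots> \<le> (s + 1) * n" using elim by (simp add: divide_less_eq)
            finally show ?thesis .
          qed
          then show ?case by (simp add: D_def Z_def P_def g_def truncated_product_def)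
        qed
        then show ?case using mcleish_product_limit[OF elim, of u] by (rule tendsto_cong[THEN iffD1])
      qed
    qed
    then have "(\<lambda>n. expectation (D n) + of_real g) \<longlonglongrightarrow> 0 + of_real g" by (intro tendsto_intros)
    moreover have "expectation (D n) + of_real g = char (distr M borel (\<lambda>x. (\<Sum>t<n. e t x) / sqrt n)) u" for n
    proof -
      have "expectation (D n) = expectation (Z n) - of_real g"
        unfolding D_def P_def using Z_int expectation_truncated_product[OF L, of "u / sqrt n" n n] by simp
      moreover have "char (distr M borel (\<lambda>x. (\<Sum>t<n. e t x) / sqrt n)) u = expectation (Z n)"
        unfolding char_def Z_def[abs_def] by (rule integral_distr) auto
      ultimately show ?thesis by simp
    qed
    ultimately show "(\<lambda>n. char (distr M borel (\<lambda>x. (\<Sum>t<n. e t x) / sqrt n)) u) \<longlonglongrightarrow> char (normal_law 0 s) u"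
      by (simp add: char_normal_law[OF s] g_def)
  qed
qed

end

section \<open>Beta prime mixtures and independence\<close>

text \<open>The mean is read off from the derivative of \<open>x\<^sup>m (1 + x)\<^sup>-\<^sup>m\<^sup>-\<^sup>l\<close>, which is the density times
  \<open>m - l x\<close> up to the Beta factor and integrates to \<open>0\<close> over \<open>(0, \<infinity>)\<close>.\<close>

lemma beta_prime_mean:
  assumes m: "0 < m" and l: "0 < l"
    and total: "(\<integral>\<^sup>+x. ennreal (beta_prime_density m l x) \<partial>lborel) = 1"
  shows "(\<integral>\<^sup>+x. ennreal (beta_prime_density m l x) * ennreal x \<partial>lborel) = ennreal (m / l)"
proof -
  define B where "B = Beta m (l + 1)"
  have B: "0 < B" unfolding B_def Beta_def using m l by (intro divide_pos_pos mult_pos_pos Gamma_real_pos) auto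
  define f where "f = beta_prime_density m l"
  have f_nonneg: "0 \<le> f x" for x unfolding f_def beta_prime_density_def using B by (auto simp: B_def)
  have f_pos: "f x = x powr (m - 1) * (1 + x) powr (- m - l - 1) / B" if "0 < x" for x
    using that by (simp add: f_def beta_prime_density_def B_def)
  have [measurable]: "f \<in> borel_measurable borel" unfolding f_def beta_prime_density_def by measurable
  define F where "F x = x powr m * (1 + x) powr (- m - l) / B" for x
  \<comment> \<open>\<open>m - l * x\<close> changes sign at \<open>a\<close>. The form of the
    fundamental theorem used below asks for a nonnegative integrand, so the half line is split there
    and the sign reversed on the right.\<close>
  define a where "a = m / l"
  have a: "0 < a" using m l by (simp add: a_def)
  have deriv: "DERIV F x :> f x * (m - l * x)" if x: "0 < x" for x
  proof -
    have "DERIV F x :> (m * x powr (m - 1) * (1 + x) powr (- m - l) +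
        x powr m * ((- m - l) * (1 + x) powr (- m - l - 1))) / B"
      unfolding F_def using x B by (auto intro!: derivative_eq_intros simp: field_simps)
    moreover have "x powr m = x * x powr (m - 1)"
      using x by (simp add: powr_diff)
    moreover have "(1 + x) powr (- m - l) = (1 + x) * (1 + x) powr (- m - l - 1)"
      using x powr_add[of "1 + x" 1 "- m - l - 1"] by simp
    ultimately show ?thesis using x B by (simp add: f_pos) (simp add: field_simps)
  qed
  have cont: "isCont (\<lambda>x. f x * (m - l * x)) x" if x: "0 < x" for x
  proof -
    have "isCont (\<lambda>x. x powr (m - 1) * (1 + x) powr (- m - l - 1) / B * (m - l * x)) x"
      using x B by (intro continuous_intros) auto
    moreover have "eventually (\<lambda>x. x powr (m - 1) * (1 + x) powr (- m - l - 1) / B * (m - l * x) =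
        f x * (m - l * x)) (nhds x)"
      using eventually_nhds_in_open[of "{0<..}" x] x by (auto simp: f_pos elim!: eventually_mono)
    ultimately show ?thesis by (simp add: isCont_cong)
  qed
  have F_0: "(F \<longlongrightarrow> 0) (at_right 0)"
  proof -
    have "((\<lambda>x. x powr m * (1 + x) powr (- m - l) / B) \<longlongrightarrow> 0 powr m * (1 + 0) powr (- m - l) / B) (at_right 0)"
      using m B by (intro tendsto_intros) (auto simp: eventually_at_filter)
    then show ?thesis by (simp add: F_def[abs_def])
  qed
  have F_a: "isCont F a" using deriv[OF a] by (rule DERIV_isCont)
  have F_top: "(F \<longlongrightarrow> 0) at_top"
  proof (rule tendsto_sandwich)
    show "eventually (\<lambda>x. 0 \<le> F x) at_top" using B by (intro always_eventually) (simp add: F_def)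
    show "eventually (\<lambda>x. F x \<le> (1 + x) powr (- l) / B) at_top"
      using eventually_gt_at_top[of 0]
    proof eventually_elim
      case (elim x)
      have "x powr m * (1 + x) powr (- m - l) \<le> (1 + x) powr m * (1 + x) powr (- m - l)"
        using elim m by (intro mult_right_mono powr_mono2) auto
      also have "\<dots> = (1 + x) powr (- l)" by (simp add: powr_add[symmetric])
      finally show ?case using B by (simp add: F_def divide_right_mono)
    qed
    have "((\<lambda>x. (1 + x) powr (- l)) \<longlongrightarrow> 0) at_top"
      using l by (intro tendsto_neg_powr filterlim_tendsto_add_at_top[OF tendsto_const] filterlim_ident) auto
    then show "((\<lambda>x. (1 + x) powr (- l) / B) \<longlongrightarrow> 0) at_top" by (rule tendsto_divide_zero)
  qed simp
  have left: "set_integrable lborel (einterval 0 a) (\<lambda>x. f x * (m - l * x))"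
      "(LBINT x=0..a. f x * (m - l * x)) = F a - 0"
  proof -
    note * = interval_integral_FTC_nonneg[where a=0 and b="ereal a" and F=F and f="\<lambda>x. f x * (m - l * x)" and A=0 and B="F a"]
    have prem: "((F \<circ> real_of_ereal) \<longlongrightarrow> 0) (at_right 0)" "((F \<circ> real_of_ereal) \<longlongrightarrow> F a) (at_left (ereal a))"
      using F_0 F_a by (auto simp: zero_ereal_def ereal_tendsto_simps isCont_def intro: filterlim_at_split[THEN iffD1, THEN conjunct1])
    have nonneg: "0 \<le> f x * (m - l * x)" if "x < a" for x
    proof -
      have "0 \<le> m - l * x" using that l by (simp add: a_def field_simps)
      then show ?thesis using f_nonneg[of x] by simp
    qed
    show "set_integrable lborel (einterval 0 a) (\<lambda>x. f x * (m - l * x))"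
      by (rule *) (use a deriv cont prem nonneg in \<open>auto\<close>)
    show "(LBINT x=0..a. f x * (m - l * x)) = F a - 0"
      by (rule *) (use a deriv cont prem nonneg in \<open>auto\<close>)
  qed
  have right: "set_integrable lborel (einterval a \<infinity>) (\<lambda>x. - (f x * (m - l * x)))"
      "(LBINT x=a..\<infinity>. - (f x * (m - l * x))) = 0 - (- F a)"
  proof -
    note * = interval_integral_FTC_nonneg[where a="ereal a" and b="\<infinity>" and F="\<lambda>x. - F x" and f="\<lambda>x. - (f x * (m - l * x))" and A="- F a" and B=0]
    have "((\<lambda>x. - F x) \<longlongrightarrow> - F a) (at_right a)" "((\<lambda>x. - F x) \<longlongrightarrow> - 0) at_top"
      using F_a tendsto_minus[OF F_top] by (auto intro!: tendsto_minus simp: isCont_def filterlim_at_split)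
    then have prem: "(((\<lambda>x. - F x) \<circ> real_of_ereal) \<longlongrightarrow> - F a) (at_right (ereal a))"
      "(((\<lambda>x. - F x) \<circ> real_of_ereal) \<longlongrightarrow> 0) (at_left \<infinity>)"
      unfolding ereal_tendsto_simps by simp_all
    have nonneg: "0 \<le> - (f x * (m - l * x))" if "a < x" for x
    proof -
      have "m - l * x \<le> 0" using that l by (simp add: a_def field_simps)
      then show ?thesis using f_nonneg[of x] by (simp add: mult_nonneg_nonpos)
    qed
    have d: "DERIV (\<lambda>x. - F x) x :> - (f x * (m - l * x))" if "a < x" for x
      using deriv[of x] that a by (intro DERIV_minus) auto
    have c: "isCont (\<lambda>x. - (f x * (m - l * x))) x" if "a < x" for x
      using cont[of x] that a by (intro isCont_minus) auto
    show "set_integrable lborel (einterval a \<infinity>) (\<lambda>x. - (f x * (m - l * x)))"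
      by (rule *) (use a d c prem nonneg in \<open>auto\<close>)
    show "(LBINT x=a..\<infinity>. - (f x * (m - l * x))) = 0 - (- F a)"
      by (rule *) (use a d c prem nonneg in \<open>auto\<close>)
  qed
  have "has_bochner_integral lborel (\<lambda>x. indicator (einterval 0 a) x *\<^sub>R (f x * (m - l * x))) (F a)"
    using left a by (simp add: has_bochner_integral_iff set_integrable_def interval_lebesgue_integral_def set_lebesgue_integral_def zero_ereal_def)
  moreover have "has_bochner_integral lborel (\<lambda>x. indicator (einterval a \<infinity>) x *\<^sub>R - (f x * (m - l * x))) (F a)"
    using right a by (simp add: has_bochner_integral_iff set_integrable_def interval_lebesgue_integral_def set_lebesgue_integral_def)
  ultimately have diff: "has_bochner_integral lborel (\<lambda>x. indicator (einterval 0 a) x *\<^sub>R (f x * (m - l * x)) -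
      indicator (einterval a \<infinity>) x *\<^sub>R - (f x * (m - l * x))) (F a - F a)"
    by (rule has_bochner_integral_diff)
  \<comment> \<open>The boundary values at \<open>a\<close> cancel, and the point \<open>a\<close>,
    which belongs to neither interval, is null.\<close>
  have "has_bochner_integral lborel (\<lambda>x. f x * (m - l * x)) (F a - F a)"
  proof (rule has_bochner_integral_cong_AE[THEN iffD1, OF _ _ _ diff])
    show "AE x in lborel. indicator (einterval 0 a) x *\<^sub>R (f x * (m - l * x)) -
        indicator (einterval a \<infinity>) x *\<^sub>R - (f x * (m - l * x)) = f x * (m - l * x)"
      using AE_lborel_singleton[of a]
    proof eventually_elim
      case (elim x)
      have "f x = 0" if "x \<le> 0" using that by (simp add: f_def beta_prime_density_def)
      then show ?case using elim a by (cases "x \<le> 0") (auto simp: indicator_def einterval_def)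
    qed
  qed (auto intro: borel_measurable_has_bochner_integral[OF diff])
  moreover have "has_bochner_integral lborel (\<lambda>x. m * f x) (m * 1)"
    by (intro has_bochner_integral_mult_right has_bochner_integral_nn_integral)
       (use total[folded f_def] f_nonneg in auto)
  \<comment> \<open>With total mass one, subtracting the vanishing integral of
    \<open>f x * (m - l * x)\<close> from \<open>m\<close> leaves \<open>l\<close> times the
    mean.\<close>
  ultimately have "has_bochner_integral lborel (\<lambda>x. (m * f x - f x * (m - l * x)) / l) ((m * 1 - (F a - F a)) / l)"
    by (intro has_bochner_integral_divide has_bochner_integral_diff)
  then have "has_bochner_integral lborel (\<lambda>x. f x * x) (m / l)"
    using l by (simp add: field_simps)
  moreover have nonneg: "0 \<le> f x * x" for x
  proof (cases "0 < x")
    case False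
    then have "f x = 0" by (simp add: f_def beta_prime_density_def)
    then show ?thesis by simp
  qed (simp add: f_nonneg)
  ultimately have "(\<integral>\<^sup>+x. ennreal (f x * x) \<partial>lborel) = ennreal (m / l)"
    by (subst nn_integral_eq_integral) (auto simp: has_bochner_integral_iff)
  moreover have "ennreal (f x * x) = ennreal (f x) * ennreal x" for x
    by (rule ennreal_mult'[OF f_nonneg])
  ultimately show ?thesis by (simp add: f_def)
qed

section \<open>Geometric counts and sums of random length\<close>

lemma geom_pmf_nonneg: "0 < x \<Longrightarrow> 0 \<le> geom_pmf x k"
  by (simp add: geom_pmf_def)

lemma borel_measurable_geom_pmf [measurable]: "(\<lambda>x. geom_pmf x k) \<in> borel_measurable borel"
  unfolding geom_pmf_def by measurable

text \<open>With \<open>p = x / (1 + x)\<close> the series is a differentiated geometric series; its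
  term at zero vanishes, which permits the shift of index.\<close>

lemma nn_integral_of_nat_geom_pmf:
  assumes x: "0 < x"
  shows "(\<integral>\<^sup>+k. of_nat k * ennreal (geom_pmf x k) \<partial>count_space UNIV) = ennreal x"
proof -
  define p where "p = x / (1 + x)"
  have p: "0 < p" "p < 1" using x by (auto simp: p_def)
  have "(\<lambda>n. of_nat (Suc n) * p ^ n * (p / (1 + x))) sums (1 / (1 - p)\<^sup>2 * (p / (1 + x)))"
    by (intro sums_mult2 geometric_deriv_sums) (use p in simp)
  moreover have "1 / (1 - p)\<^sup>2 * (p / (1 + x)) = x"
  proof -
    have "1 - p = 1 / (1 + x)" using x by (simp add: p_def field_simps)
    then show ?thesis using x by (simp add: p_def power2_eq_square)
  qed
  moreover have "of_nat (Suc n) * p ^ n * (p / (1 + x)) = real (Suc n) * geom_pmf x (Suc n)" for n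
    using x by (simp add: p_def geom_pmf_def power_divide field_simps)
  ultimately have "(\<lambda>n. real (Suc n) * geom_pmf x (Suc n)) sums x" by simp
  then have "(\<lambda>n. real n * geom_pmf x n) sums x"
    using sums_Suc_iff[of "\<lambda>n. real n * geom_pmf x n" x] by simp
  moreover have "0 \<le> real n * geom_pmf x n" for n using x by (simp add: geom_pmf_def)
  ultimately have "(\<Sum>n. ennreal (real n * geom_pmf x n)) = ennreal x"
    by (intro suminf_ennreal_eq)
  then show ?thesis
    by (simp add: nn_integral_count_space_nat ennreal_mult' ennreal_of_nat_eq_real_of_nat)
qed

lemma nn_integral_count_space_singleton:
  fixes f :: "'b \<Rightarrow> ennreal"
  shows "(\<integral>\<^sup>+x. f x * indicator {x} y \<partial>count_space UNIV) = f y"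
proof -
  have "(\<integral>\<^sup>+x. f x * indicator {x} y \<partial>count_space UNIV) = (\<integral>\<^sup>+x. f y * indicator {y} x \<partial>count_space UNIV)"
    by (intro nn_integral_cong) (auto simp: indicator_def)
  then show ?thesis by (simp add: nn_integral_cmult)
qed

lemma borel_measurable_nn_integral_count_space_nat:
  fixes f :: "nat \<Rightarrow> 'a \<Rightarrow> ennreal"
  assumes "\<And>i. f i \<in> borel_measurable M"
  shows "(\<lambda>x. \<integral>\<^sup>+i. f i x \<partial>count_space UNIV) \<in> borel_measurable M"
  using assms by (simp add: nn_integral_count_space_nat)

text \<open>A sum of random length becomes an integral over a fixed index set, with the length moved
  into a cut-off, so that it can be exchanged with an expectation.\<close>

lemma of_nat_sum_eq_nn_integral:
  fixes g :: "nat \<Rightarrow> nat"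
  shows "(of_nat (\<Sum>j<n. g j) :: ennreal) = (\<integral>\<^sup>+j. of_bool (j < n) * of_nat (g j) \<partial>count_space UNIV)"
proof -
  have "(\<integral>\<^sup>+j. of_bool (j < n) * (of_nat (g j) :: ennreal) \<partial>count_space UNIV) = (\<Sum>j. of_bool (j < n) * of_nat (g j))"
    by (rule nn_integral_count_space_nat)
  also have "\<dots> = (\<Sum>j<n. of_bool (j < n) * of_nat (g j))"
    by (rule suminf_finite) auto
  finally show ?thesis by simp
qed

lemma of_nat_eq_nn_integral:
  "(of_nat n :: ennreal) = (\<integral>\<^sup>+j. of_bool (j < n) \<partial>count_space UNIV)"
  using of_nat_sum_eq_nn_integral[of "\<lambda>_. 1" n] by simp

section \<open>Independence of variables with different value spaces\<close>

context prob_space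
begin

text \<open>Mapping into a common space \<open>K\<close> leads to \<open>indep_var\<close>, for
  which product formulas are available; every event of the composed variables is already an event of
  \<open>U\<close> or of \<open>V\<close>.\<close>

lemma indep_rv_compose:
  assumes ind: "indep_rv N U N' V" and f: "f \<in> measurable N K" and g: "g \<in> measurable N' K"
  shows "indep_var K (\<lambda>\<omega>. f (U \<omega>)) K (\<lambda>\<omega>. g (V \<omega>))"
proof -
  have [measurable]: "U \<in> measurable M N" "V \<in> measurable M N'"
    and set: "indep_set {U -` A \<inter> space M | A. A \<in> sets N} {V -` A \<inter> space M | A. A \<in> sets N'}"
    using ind by (auto simp: indep_rv_def)
  note [measurable] = f g
  have rv: "random_variable K (\<lambda>\<omega>. f (U \<omega>))" "random_variable K (\<lambda>\<omega>. g (V \<omega>))" by measurable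
  show ?thesis
    unfolding indep_var_eq
  proof (intro conjI indep_set_sigma_sets rv)
    show "indep_set {(\<lambda>\<omega>. f (U \<omega>)) -` A \<inter> space M |A. A \<in> sets K}
        {(\<lambda>\<omega>. g (V \<omega>)) -` A \<inter> space M |A. A \<in> sets K}"
    proof (safe intro!: indep_setI)
      fix A B assume A: "A \<in> sets K" and B: "B \<in> sets K"
      show "(\<lambda>\<omega>. f (U \<omega>)) -` A \<inter> space M \<in> events" using rv(1) A by (rule measurable_sets)
      show "(\<lambda>\<omega>. g (V \<omega>)) -` A \<inter> space M \<in> events" using rv(2) A by (rule measurable_sets)
      have "(\<lambda>\<omega>. f (U \<omega>)) -` A \<inter> space M = U -` (f -` A \<inter> space N) \<inter> space M"
        using measurable_space[OF \<open>U \<in> measurable M N\<close>] by auto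
      moreover have "(\<lambda>\<omega>. g (V \<omega>)) -` B \<inter> space M = V -` (g -` B \<inter> space N') \<inter> space M"
        using measurable_space[OF \<open>V \<in> measurable M N'\<close>] by auto
      moreover have "U -` (f -` A \<inter> space N) \<inter> space M \<in> {U -` A \<inter> space M | A. A \<in> sets N}"
        using measurable_sets[OF f A] by blast
      moreover have "V -` (g -` B \<inter> space N') \<inter> space M \<in> {V -` A \<inter> space M | A. A \<in> sets N'}"
        using measurable_sets[OF g B] by blast
      ultimately show "prob (((\<lambda>\<omega>. f (U \<omega>)) -` A \<inter> space M) \<inter> ((\<lambda>\<omega>. g (V \<omega>)) -` B \<inter> space M)) =
          prob ((\<lambda>\<omega>. f (U \<omega>)) -` A \<inter> space M) * prob ((\<lambda>\<omega>. g (V \<omega>)) -` B \<inter> space M)"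
        by (simp only: indep_setD[OF set])
    qed
  next
    show "Int_stable {(\<lambda>\<omega>. f (U \<omega>)) -` A \<inter> space M |A. A \<in> sets K}"
      by (auto intro!: Int_stableI) (metis (no_types, lifting) Int_assoc Int_left_commute inf.idem sets.Int vimage_Int)
    show "Int_stable {(\<lambda>\<omega>. g (V \<omega>)) -` A \<inter> space M |A. A \<in> sets K}"
      by (auto intro!: Int_stableI) (metis (no_types, lifting) Int_assoc Int_left_commute inf.idem sets.Int vimage_Int)
  qed
qed

text \<open>In extended nonnegative reals the product formula applies before integrability is known,
  which is the situation when the thinning is expanded.\<close>

lemma indep_var_nn_integral_mult:
  fixes X Y :: "'a \<Rightarrow> ennreal"
  assumes "indep_var borel X borel Y"
  shows "(\<integral>\<^sup>+\<omega>. X \<omega> * Y \<omega> \<partial>M) = (\<integral>\<^sup>+\<omega>. X \<omega> \<partial>M) * (\<integral>\<^sup>+\<omega>. Y \<omega> \<partial>M)"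
proof -
  have "indep_vars (\<lambda>_. borel) (case_bool X Y) UNIV"
    using assms unfolding indep_var_def
    by (rule indep_vars_cong[THEN iffD1, rotated -1]) (auto split: bool.split)
  from indep_vars_nn_integral[OF _ this] show ?thesis by (simp add: UNIV_bool mult.commute)
qed

end

section \<open>Conditional moments of the process\<close>

lemma subalgebra_vimage_algebra:
  assumes f: "f \<in> measurable M N"
  shows "subalgebra M (vimage_algebra (space M) f N)"
proof -
  have "f \<in> space M \<rightarrow> space N" using measurable_space[OF f] by auto
  then show ?thesis
    using measurable_sets[OF f] by (auto simp: subalgebra_def sets_vimage_algebra2)
qed

text \<open>Indexing coordinates by the numeral type lets one argument serve both components and
  exhibits each as a function of the pair, which measurability with respect to the past calls
  for.\<close>

definition component :: "2 \<Rightarrow> nat \<times> nat \<Rightarrow> nat" where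
  "component i p = (if i = 1 then fst p else snd p)"

lemma component_both [simp]: "component i (both X t \<omega>) = X i t \<omega>"
  using exhaust_2[of i] by (auto simp: component_def both_def)

context brcmnbinar
begin

definition past :: "nat \<Rightarrow> 'a \<Rightarrow> nat \<Rightarrow> nat \<times> nat" where
  "past t \<omega> = (\<lambda>s\<in>{..<t}. both X s \<omega>)"

abbreviation past_space :: "nat \<Rightarrow> (nat \<Rightarrow> nat \<times> nat) measure" where
  "past_space t \<equiv> Pi\<^sub>M {..<t} (\<lambda>_. count_space UNIV)"

definition thinned :: "2 \<Rightarrow> nat \<Rightarrow> 'a \<Rightarrow> nat" where
  "thinned i t = nb_op (G i t) (X i (t - 1))"

lemma measurable_X [measurable]: "X i t \<in> measurable M (count_space UNIV)"
  by (rule X_measurable)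

lemma measurable_both_X [measurable]: "both X t \<in> measurable M (count_space UNIV)"
proof -
  have "(\<lambda>\<omega>. (X 1 t \<omega>, X 2 t \<omega>)) \<in> measurable M (count_space UNIV \<Otimes>\<^sub>M count_space UNIV)"
    by measurable
  then show ?thesis
    by (simp add: both_def[abs_def] pair_measure_countable)
qed

lemma measurable_past [measurable]: "past t \<in> measurable M (past_space t)"
  unfolding past_def by measurable

lemma measurable_\<alpha>: "1 \<le> t \<Longrightarrow> \<alpha> i t \<in> borel_measurable M"
  using distributed_measurable[OF \<alpha>_distributed] by simp

lemma AE_\<alpha>_pos: "1 \<le> t \<Longrightarrow> AE \<omega> in M. 0 < \<alpha> i t \<omega>"
  by (subst distributed_AE2[OF \<alpha>_distributed]) (auto simp: beta_prime_density_def)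

lemma nn_integral_\<alpha>:
  assumes t: "1 \<le> t"
  shows "(\<integral>\<^sup>+\<omega>. ennreal (\<alpha> i t \<omega>) \<partial>M) = ennreal (m i / l)"
proof -
  have "(\<integral>\<^sup>+x. ennreal (beta_prime_density (m i) l x) * 1 \<partial>lborel) = (\<integral>\<^sup>+\<omega>. 1 \<partial>M)"
    by (rule distributed_nn_integral[OF \<alpha>_distributed[OF t]]) simp
  then have "(\<integral>\<^sup>+x. ennreal (beta_prime_density (m i) l x) \<partial>lborel) = 1"
    by (simp add: emeasure_space_1)
  then have "(\<integral>\<^sup>+x. ennreal (beta_prime_density (m i) l x) * ennreal x \<partial>lborel) = ennreal (m i / l)"
    using m_bounds[of i] l_gt_1 by (intro beta_prime_mean) auto
  then show ?thesis
    using distributed_nn_integral[OF \<alpha>_distributed[OF t, of i], of ennreal] by simp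
qed

lemma nn_integral_\<alpha>_mult:
  assumes t: "1 \<le> t"
  shows "(\<integral>\<^sup>+\<omega>. ennreal (\<alpha> 1 t \<omega>) * ennreal (\<alpha> 2 t \<omega>) \<partial>M) = ennreal (m 1 / l) * ennreal (m 2 / l)"
proof -
  have "(\<lambda>x::nat \<Rightarrow> real. ennreal (x t)) \<in> borel_measurable (Pi\<^sub>M {1..} (\<lambda>_. borel))"
    by (rule measurable_compose[OF measurable_component_singleton[of t "{1..}" "\<lambda>_. borel"] measurable_ennreal])
       (use t in simp)
  from indep_var_compose[OF \<alpha>_mutually_indep this this]
  have "indep_var borel (\<lambda>\<omega>. ennreal (\<alpha> 1 t \<omega>)) borel (\<lambda>\<omega>. ennreal (\<alpha> 2 t \<omega>))"
    using t by (simp add: comp_def)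
  then show ?thesis
    by (simp add: indep_var_nn_integral_mult nn_integral_\<alpha>[OF t])
qed

text \<open>Integrating the conditional law removes the conditioning: the counts follow a mixture of
  products of geometric laws. The moments of the counting variables are read off from this.\<close>

lemma emeasure_G:
  assumes J: "finite J" "J \<subseteq> UNIV \<times> {1..} \<times> UNIV"
  shows "emeasure M {\<omega> \<in> space M. \<forall>(i, t, j)\<in>J. G i t j \<omega> = k i t j} =
    (\<integral>\<^sup>+\<omega>. ennreal (\<Prod>(i, t, j)\<in>J. geom_pmf (\<alpha> i t \<omega>) (k i t j)) \<partial>M)"
proof -
  let ?H = "vimage_algebra (space M) (\<lambda>\<omega>. \<lambda>(i, t)\<in>UNIV \<times> {1..}. \<alpha> i t \<omega>)
                 (Pi\<^sub>M (UNIV \<times> {1..}) (\<lambda>_. borel))"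
  let ?S = "{\<omega> \<in> space M. \<forall>(i, t, j)\<in>J. G i t j \<omega> = k i t j}"
  let ?P = "\<lambda>\<omega>. \<Prod>(i, t, j)\<in>J. geom_pmf (\<alpha> i t \<omega>) (k i t j)"
  have "(\<lambda>\<omega>. \<lambda>x\<in>UNIV \<times> {1..}. \<alpha> (fst x) (snd x) \<omega>) \<in> measurable M (Pi\<^sub>M (UNIV \<times> {1..}) (\<lambda>_. borel))"
    by (intro measurable_restrict measurable_\<alpha>) auto
  then have "subalgebra M ?H"
    by (intro subalgebra_vimage_algebra) (simp add: case_prod_unfold)
  then interpret H: finite_measure_subalgebra M ?H
    by unfold_locales
  have S: "?S \<in> sets M"
  proof -
    have "{\<omega> \<in> space M. G (fst x) (fst (snd x)) (snd (snd x)) \<omega> = k (fst x) (fst (snd x)) (snd (snd x))} \<in> sets M"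
      if "x \<in> J" for x
    proof -
      have [measurable]: "G (fst x) (fst (snd x)) (snd (snd x)) \<in> measurable M (count_space UNIV)"
        using that J by (intro G_measurable) auto
      show ?thesis by measurable
    qed
    from sets.sets_Collect_finite_All[OF this J(1)] show ?thesis
      by (simp add: case_prod_beta)
  qed
  have P_meas: "?P \<in> borel_measurable M"
  proof (rule borel_measurable_prod)
    fix x assume x: "x \<in> J"
    obtain i t j where [simp]: "x = (i, t, j)" by (cases x) auto
    have [measurable]: "\<alpha> i t \<in> borel_measurable M" using x J by (intro measurable_\<alpha>) auto
    show "(\<lambda>\<omega>. case x of (i, t, j) \<Rightarrow> geom_pmf (\<alpha> i t \<omega>) (k i t j)) \<in> borel_measurable M"
      by simp
  qed
  have ind: "integrable M (indicator ?S :: 'a \<Rightarrow> real)"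
    by (rule integrable_const_bound[of _ 1]) (use S in auto)
  have eq: "AE \<omega> in M. real_cond_exp M ?H (indicator ?S) \<omega> = ?P \<omega>"
    by (rule G_conditional[OF J])
  \<comment> \<open>The product inherits its sign from the conditional expectation that it
    represents.\<close>
  have "AE \<omega> in M. 0 \<le> real_cond_exp M ?H (indicator ?S) \<omega>"
    by (rule H.real_cond_exp_pos) (use S in auto)
  with eq have pos: "AE \<omega> in M. 0 \<le> ?P \<omega>" by eventually_elim simp
  have int: "integrable M ?P"
    by (rule integrable_cong_AE_imp[OF H.real_cond_exp_int(1)[OF ind] P_meas]) (use eq in \<open>auto elim: eventually_mono\<close>)
  have "(\<integral>\<^sup>+\<omega>. ennreal (?P \<omega>) \<partial>M) = ennreal (expectation ?P)"
    by (rule nn_integral_eq_integral[OF int pos])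
  also have "expectation ?P = expectation (real_cond_exp M ?H (indicator ?S))"
    by (rule integral_cong_AE) (use P_meas eq in \<open>auto elim: eventually_mono\<close>)
  also have "\<dots> = prob ?S"
    using H.real_cond_exp_int(2)[OF ind] S by (simp add: Int_absorb1 sets.sets_into_space)
  finally show ?thesis by (simp add: emeasure_eq_measure)
qed

lemma of_nat_eq_nn_integral_indicator:
  "\<omega> \<in> space M \<Longrightarrow> (of_nat (g \<omega>) :: ennreal) =
    (\<integral>\<^sup>+a. of_nat a * indicator {\<omega> \<in> space M. g \<omega> = a} \<omega> \<partial>count_space UNIV)"
  by (subst nn_integral_count_space_singleton[of of_nat "g \<omega>", symmetric])
     (auto intro!: nn_integral_cong simp: indicator_def)

text \<open>Summing over the values and exchanging sum and expectation leaves the geometric mean for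
  each coefficient, hence the mean of the coefficient.\<close>

lemma nn_integral_G:
  assumes t: "1 \<le> t"
  shows "(\<integral>\<^sup>+\<omega>. of_nat (G i t j \<omega>) \<partial>M) = ennreal (m i / l)"
proof -
  note [measurable] = G_measurable[OF t] measurable_\<alpha>[OF t]
  have pr: "emeasure M {\<omega> \<in> space M. G i t j \<omega> = a} = (\<integral>\<^sup>+\<omega>. ennreal (geom_pmf (\<alpha> i t \<omega>) a) \<partial>M)" for a
    using emeasure_G[of "{(i, t, j)}" "\<lambda>_ _ _. a"] t by simp
  have "(\<integral>\<^sup>+\<omega>. of_nat (G i t j \<omega>) \<partial>M) =
      (\<integral>\<^sup>+\<omega>. \<integral>\<^sup>+a. of_nat a * indicator {\<omega> \<in> space M. G i t j \<omega> = a} \<omega> \<partial>count_space UNIV \<partial>M)"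
    by (intro nn_integral_cong of_nat_eq_nn_integral_indicator)
  also have "\<dots> = (\<integral>\<^sup>+a. \<integral>\<^sup>+\<omega>. of_nat a * indicator {\<omega> \<in> space M. G i t j \<omega> = a} \<omega> \<partial>M \<partial>count_space UNIV)"
    by (rule nn_integral_count_space_nn_integral) auto
  also have "\<dots> = (\<integral>\<^sup>+a. \<integral>\<^sup>+\<omega>. of_nat a * ennreal (geom_pmf (\<alpha> i t \<omega>) a) \<partial>M \<partial>count_space UNIV)"
    by (rule nn_integral_cong) (simp add: nn_integral_cmult pr)
  also have "\<dots> = (\<integral>\<^sup>+\<omega>. \<integral>\<^sup>+a. of_nat a * ennreal (geom_pmf (\<alpha> i t \<omega>) a) \<partial>count_space UNIV \<partial>M)"
    by (rule nn_integral_count_space_nn_integral[symmetric]) auto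
  also have "\<dots> = (\<integral>\<^sup>+\<omega>. ennreal (\<alpha> i t \<omega>) \<partial>M)"
    by (rule nn_integral_cong_AE)
       (use AE_\<alpha>_pos[OF t, of i] in eventually_elim, simp add: nn_integral_of_nat_geom_pmf)
  finally show ?thesis by (simp add: nn_integral_\<alpha>[OF t])
qed

text \<open>Given the coefficients the two counts are independent with means
  \<open>\<alpha> 1 t\<close> and \<open>\<alpha> 2 t\<close>, and the mean of the product of the
  coefficients factorises by their mutual independence. This is the source of the vanishing
  conditional covariance.\<close>

lemma nn_integral_G_mult:
  assumes t: "1 \<le> t"
  shows "(\<integral>\<^sup>+\<omega>. of_nat (G 1 t j \<omega>) * of_nat (G 2 t j' \<omega>) \<partial>M) = ennreal (m 1 / l) * ennreal (m 2 / l)"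
proof -
  note [measurable] = G_measurable[OF t] measurable_\<alpha>[OF t]
  let ?E = "\<lambda>a b. {\<omega> \<in> space M. G 1 t j \<omega> = a \<and> G 2 t j' \<omega> = b}"
  let ?p = "\<lambda>i a \<omega>. ennreal (geom_pmf (\<alpha> i t \<omega>) a)"
  have pr: "emeasure M (?E a b) = (\<integral>\<^sup>+\<omega>. ?p 1 a \<omega> * ?p 2 b \<omega> \<partial>M)" for a b
  proof -
    \<comment> \<open>A single index set carries both components, so the prescribed values are
      encoded by a case distinction on \<open>i\<close>.\<close>
    have "emeasure M (?E a b) = (\<integral>\<^sup>+\<omega>. ennreal (geom_pmf (\<alpha> 1 t \<omega>) a * geom_pmf (\<alpha> 2 t \<omega>) b) \<partial>M)"
      using emeasure_G[of "{(1, t, j), (2, t, j')}" "\<lambda>i _ _. if i = 1 then a else b"] t by simp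
    also have "\<dots> = (\<integral>\<^sup>+\<omega>. ?p 1 a \<omega> * ?p 2 b \<omega> \<partial>M)"
      by (rule nn_integral_cong_AE)
         (use AE_\<alpha>_pos[OF t, of 1] in eventually_elim, simp add: ennreal_mult' geom_pmf_nonneg)
    finally show ?thesis .
  qed
  have "(\<integral>\<^sup>+\<omega>. of_nat (G 1 t j \<omega>) * of_nat (G 2 t j' \<omega>) \<partial>M) =
      (\<integral>\<^sup>+\<omega>. \<integral>\<^sup>+a. \<integral>\<^sup>+b. of_nat a * of_nat b * indicator (?E a b) \<omega> \<partial>count_space UNIV \<partial>count_space UNIV \<partial>M)"
  proof (intro nn_integral_cong)
    fix \<omega> assume \<omega>: "\<omega> \<in> space M"
    have "(of_nat (G 1 t j \<omega>) :: ennreal) * of_nat (G 2 t j' \<omega>) =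
        (\<integral>\<^sup>+a. of_nat a * indicator {\<omega> \<in> space M. G 1 t j \<omega> = a} \<omega> \<partial>count_space UNIV) *
        (\<integral>\<^sup>+b. of_nat b * indicator {\<omega> \<in> space M. G 2 t j' \<omega> = b} \<omega> \<partial>count_space UNIV)"
      by (simp only: of_nat_eq_nn_integral_indicator[OF \<omega>, symmetric])
    also have "\<dots> = (\<integral>\<^sup>+a. \<integral>\<^sup>+b. of_nat a * indicator {\<omega> \<in> space M. G 1 t j \<omega> = a} \<omega> *
        (of_nat b * indicator {\<omega> \<in> space M. G 2 t j' \<omega> = b} \<omega>) \<partial>count_space UNIV \<partial>count_space UNIV)"
      by (simp add: nn_integral_cmult nn_integral_multc)
    also have "\<dots> = (\<integral>\<^sup>+a. \<integral>\<^sup>+b. of_nat a * of_nat b * indicator (?E a b) \<omega> \<partial>count_space UNIV \<partial>count_space UNIV)"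
      by (intro nn_integral_cong) (auto simp: indicator_def)
    finally show "(of_nat (G 1 t j \<omega>) :: ennreal) * of_nat (G 2 t j' \<omega>) = \<dots>" .
  qed
  also have "\<dots> = (\<integral>\<^sup>+a. \<integral>\<^sup>+b. \<integral>\<^sup>+\<omega>. of_nat a * of_nat b * indicator (?E a b) \<omega> \<partial>M \<partial>count_space UNIV \<partial>count_space UNIV)"
    by (subst nn_integral_count_space_nn_integral)
       (auto intro!: nn_integral_cong nn_integral_count_space_nn_integral borel_measurable_nn_integral_count_space_nat)
  also have "\<dots> = (\<integral>\<^sup>+a. \<integral>\<^sup>+b. \<integral>\<^sup>+\<omega>. of_nat a * of_nat b * (?p 1 a \<omega> * ?p 2 b \<omega>) \<partial>M \<partial>count_space UNIV \<partial>count_space UNIV)"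
    by (rule nn_integral_cong, rule nn_integral_cong) (simp add: nn_integral_cmult pr)
  also have "\<dots> = (\<integral>\<^sup>+\<omega>. \<integral>\<^sup>+a. \<integral>\<^sup>+b. of_nat a * of_nat b * (?p 1 a \<omega> * ?p 2 b \<omega>) \<partial>count_space UNIV \<partial>count_space UNIV \<partial>M)"
    by (subst nn_integral_count_space_nn_integral)
       (auto intro!: nn_integral_cong nn_integral_count_space_nn_integral[symmetric] borel_measurable_nn_integral_count_space_nat)
  also have "\<dots> = (\<integral>\<^sup>+\<omega>. (\<integral>\<^sup>+a. of_nat a * ?p 1 a \<omega> \<partial>count_space UNIV) * (\<integral>\<^sup>+b. of_nat b * ?p 2 b \<omega> \<partial>count_space UNIV) \<partial>M)"
  proof (rule nn_integral_cong)
    fix \<omega>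
    have "(\<integral>\<^sup>+a. \<integral>\<^sup>+b. of_nat a * of_nat b * (?p 1 a \<omega> * ?p 2 b \<omega>) \<partial>count_space UNIV \<partial>count_space UNIV) =
        (\<integral>\<^sup>+a. \<integral>\<^sup>+b. (of_nat a * ?p 1 a \<omega>) * (of_nat b * ?p 2 b \<omega>) \<partial>count_space UNIV \<partial>count_space UNIV)"
      by (intro nn_integral_cong) (simp add: ac_simps)
    then show "(\<integral>\<^sup>+a. \<integral>\<^sup>+b. of_nat a * of_nat b * (?p 1 a \<omega> * ?p 2 b \<omega>) \<partial>count_space UNIV \<partial>count_space UNIV) =
        (\<integral>\<^sup>+a. of_nat a * ?p 1 a \<omega> \<partial>count_space UNIV) * (\<integral>\<^sup>+b. of_nat b * ?p 2 b \<omega> \<partial>count_space UNIV)"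
      by (simp add: nn_integral_cmult nn_integral_multc)
  qed
  also have "\<dots> = (\<integral>\<^sup>+\<omega>. ennreal (\<alpha> 1 t \<omega>) * ennreal (\<alpha> 2 t \<omega>) \<partial>M)"
    by (rule nn_integral_cong_AE)
       (use AE_\<alpha>_pos[OF t, of 1] AE_\<alpha>_pos[OF t, of 2] in eventually_elim, simp add: nn_integral_of_nat_geom_pmf)
  finally show ?thesis by (simp add: nn_integral_\<alpha>_mult[OF t])
qed

abbreviation triple_space :: "((2 \<Rightarrow> real) \<times> (2 \<times> nat \<Rightarrow> nat) \<times> nat \<times> nat) measure" where
  "triple_space \<equiv> Pi\<^sub>M UNIV (\<lambda>_. borel) \<Otimes>\<^sub>M Pi\<^sub>M UNIV (\<lambda>_. count_space UNIV) \<Otimes>\<^sub>M count_space UNIV"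

lemma measurable_G_triple [measurable]:
  "(\<lambda>w. fst (snd w) ij) \<in> measurable triple_space (count_space UNIV)"
  by (rule measurable_compose[OF measurable_compose[OF measurable_snd measurable_fst]
        measurable_component_singleton[of ij UNIV "\<lambda>_. count_space UNIV"]]) simp

text \<open>An arbitrary \<open>g\<close> of the whole triple covers a single count as well as a
  product of counts from both components.\<close>

lemma nn_integral_past_mult_G:
  assumes t: "1 \<le> t" and h: "h \<in> borel_measurable (past_space t)"
    and g: "g \<in> borel_measurable triple_space"
  shows "(\<integral>\<^sup>+\<omega>. h (past t \<omega>) * g (\<lambda>i. \<alpha> i t \<omega>, \<lambda>(i, j). G i t j \<omega>, both Z t \<omega>) \<partial>M) =
    (\<integral>\<^sup>+\<omega>. h (past t \<omega>) \<partial>M) * (\<integral>\<^sup>+\<omega>. g (\<lambda>i. \<alpha> i t \<omega>, \<lambda>(i, j). G i t j \<omega>, both Z t \<omega>) \<partial>M)"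
  using indep_var_nn_integral_mult[OF indep_rv_compose[OF triple_indep_past[OF t] g h]]
  by (simp add: past_def mult.commute)

lemma measurable_past_component [measurable]:
  assumes "s < t"
  shows "(\<lambda>x. component i (x s)) \<in> measurable (past_space t) (count_space UNIV)"
  by (rule measurable_compose[OF measurable_component_singleton[of s "{..<t}" "\<lambda>_. count_space UNIV"]])
     (use assms in auto)

lemma component_past: "s < t \<Longrightarrow> component i (past t \<omega> s) = X i s \<omega>"
  by (simp add: past_def)

lemma of_nat_thinned:
  "(of_nat (thinned i t \<omega>) :: ennreal) =
    (\<integral>\<^sup>+j. of_bool (j < X i (t - 1) \<omega> + 1) * of_nat (G i t j \<omega>) \<partial>count_space UNIV)"
  unfolding thinned_def nb_op_def by (rule of_nat_sum_eq_nn_integral)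

text \<open>Written over the number of the counting variable, the cut-off \<open>j < X + 1\<close> is a function of
  the past, so that it separates from the counting variable itself.\<close>

lemma nn_integral_past_mult_thinned:
  assumes t: "1 \<le> t" and h: "h \<in> borel_measurable (past_space t)"
  shows "(\<integral>\<^sup>+\<omega>. h (past t \<omega>) * of_nat (thinned i t \<omega>) \<partial>M) =
    ennreal (m i / l) * (\<integral>\<^sup>+\<omega>. h (past t \<omega>) * of_nat (X i (t - 1) \<omega> + 1) \<partial>M)"
proof -
  note [measurable] = h G_measurable[OF t]
  define c where "c j x = (of_bool (j < component i (x (t - 1)) + 1) :: ennreal)" for j and x :: "nat \<Rightarrow> nat \<times> nat"
  have c_past: "c j (past t \<omega>) = of_bool (j < X i (t - 1) \<omega> + 1)" for j \<omega>
    using t by (simp add: c_def component_past)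
  have [measurable]: "c j \<in> borel_measurable (past_space t)" for j
    unfolding c_def
    by (rule measurable_compose[OF measurable_past_component, where g="\<lambda>n. of_bool (j < n + 1)"]) (use t in auto)
  have "(\<integral>\<^sup>+\<omega>. h (past t \<omega>) * of_nat (thinned i t \<omega>) \<partial>M) =
      (\<integral>\<^sup>+\<omega>. \<integral>\<^sup>+j. h (past t \<omega>) * c j (past t \<omega>) * of_nat (G i t j \<omega>) \<partial>count_space UNIV \<partial>M)"
    unfolding of_nat_thinned c_past by (simp add: nn_integral_cmult[symmetric] mult.assoc)
  also have "\<dots> = (\<integral>\<^sup>+j. \<integral>\<^sup>+\<omega>. h (past t \<omega>) * c j (past t \<omega>) * of_nat (G i t j \<omega>) \<partial>M \<partial>count_space UNIV)"
    by (rule nn_integral_count_space_nn_integral) auto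
  also have "\<dots> = (\<integral>\<^sup>+j. (\<integral>\<^sup>+\<omega>. h (past t \<omega>) * c j (past t \<omega>) \<partial>M) * ennreal (m i / l) \<partial>count_space UNIV)"
  proof (rule nn_integral_cong)
    fix j
    show "(\<integral>\<^sup>+\<omega>. h (past t \<omega>) * c j (past t \<omega>) * of_nat (G i t j \<omega>) \<partial>M) =
        (\<integral>\<^sup>+\<omega>. h (past t \<omega>) * c j (past t \<omega>) \<partial>M) * ennreal (m i / l)"
      using nn_integral_past_mult_G[OF t, of "\<lambda>x. h x * c j x" "\<lambda>w. of_nat (fst (snd w) (i, j))"]
      by (simp add: nn_integral_G[OF t])
  qed
  also have "\<dots> = (\<integral>\<^sup>+j. \<integral>\<^sup>+\<omega>. h (past t \<omega>) * c j (past t \<omega>) \<partial>M \<partial>count_space UNIV) * ennreal (m i / l)"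
    by (rule nn_integral_multc) simp
  also have "(\<integral>\<^sup>+j. \<integral>\<^sup>+\<omega>. h (past t \<omega>) * c j (past t \<omega>) \<partial>M \<partial>count_space UNIV) =
      (\<integral>\<^sup>+\<omega>. \<integral>\<^sup>+j. h (past t \<omega>) * c j (past t \<omega>) \<partial>count_space UNIV \<partial>M)"
    by (rule nn_integral_count_space_nn_integral[symmetric]) auto
  also have "\<dots> = (\<integral>\<^sup>+\<omega>. h (past t \<omega>) * of_nat (X i (t - 1) \<omega> + 1) \<partial>M)"
    unfolding c_past by (simp only: of_nat_eq_nn_integral nn_integral_cmult borel_measurable_count_space)
  finally show ?thesis by (simp add: mult.commute)
qed

text \<open>Every pair of counts from the two components has the same mean product, so expanding
  both sums only counts the pairs below the two cut-offs. In effect the conditional mean of the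
  product is the product of the conditional means.\<close>

lemma nn_integral_past_mult_thinned_thinned:
  assumes t: "1 \<le> t" and h: "h \<in> borel_measurable (past_space t)"
  shows "(\<integral>\<^sup>+\<omega>. h (past t \<omega>) * (of_nat (thinned 1 t \<omega>) * of_nat (thinned 2 t \<omega>)) \<partial>M) =
    ennreal (m 1 / l) * ennreal (m 2 / l) *
    (\<integral>\<^sup>+\<omega>. h (past t \<omega>) * (of_nat (X 1 (t - 1) \<omega> + 1) * of_nat (X 2 (t - 1) \<omega> + 1)) \<partial>M)"
proof -
  note [measurable] = h G_measurable[OF t]
  define c where "c i j x = (of_bool (j < component i (x (t - 1)) + 1) :: ennreal)" for i j and x :: "nat \<Rightarrow> nat \<times> nat"
  have c_past: "c i j (past t \<omega>) = of_bool (j < X i (t - 1) \<omega> + 1)" for i j \<omega>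
    using t by (simp add: c_def component_past)
  have [measurable]: "c i j \<in> borel_measurable (past_space t)" for i j
    unfolding c_def
    by (rule measurable_compose[OF measurable_past_component, where g="\<lambda>n. of_bool (j < n + 1)"]) (use t in auto)
  let ?c = "\<lambda>j k \<omega>. h (past t \<omega>) * (c 1 j (past t \<omega>) * c 2 k (past t \<omega>))"
  have "(\<integral>\<^sup>+\<omega>. h (past t \<omega>) * (of_nat (thinned 1 t \<omega>) * of_nat (thinned 2 t \<omega>)) \<partial>M) =
      (\<integral>\<^sup>+\<omega>. \<integral>\<^sup>+j. \<integral>\<^sup>+k. ?c j k \<omega> * (of_nat (G 1 t j \<omega>) * of_nat (G 2 t k \<omega>)) \<partial>count_space UNIV \<partial>count_space UNIV \<partial>M)"
  proof (rule nn_integral_cong)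
    fix \<omega>
    have "h (past t \<omega>) * (of_nat (thinned 1 t \<omega>) * of_nat (thinned 2 t \<omega>)) =
        (\<integral>\<^sup>+j. \<integral>\<^sup>+k. h (past t \<omega>) * ((c 1 j (past t \<omega>) * of_nat (G 1 t j \<omega>)) *
          (c 2 k (past t \<omega>) * of_nat (G 2 t k \<omega>))) \<partial>count_space UNIV \<partial>count_space UNIV)"
      unfolding of_nat_thinned c_past by (simp add: nn_integral_cmult nn_integral_multc)
    also have "\<dots> = (\<integral>\<^sup>+j. \<integral>\<^sup>+k. ?c j k \<omega> * (of_nat (G 1 t j \<omega>) * of_nat (G 2 t k \<omega>)) \<partial>count_space UNIV \<partial>count_space UNIV)"
      by (intro nn_integral_cong) (simp add: ac_simps)
    finally show "h (past t \<omega>) * (of_nat (thinned 1 t \<omega>) * of_nat (thinned 2 t \<omega>)) = \<dots>" .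
  qed
  also have "\<dots> = (\<integral>\<^sup>+j. \<integral>\<^sup>+k. \<integral>\<^sup>+\<omega>. ?c j k \<omega> * (of_nat (G 1 t j \<omega>) * of_nat (G 2 t k \<omega>)) \<partial>M \<partial>count_space UNIV \<partial>count_space UNIV)"
    by (subst nn_integral_count_space_nn_integral)
       (auto intro!: nn_integral_cong nn_integral_count_space_nn_integral borel_measurable_nn_integral_count_space_nat)
  also have "\<dots> = (\<integral>\<^sup>+j. \<integral>\<^sup>+k. (\<integral>\<^sup>+\<omega>. ?c j k \<omega> \<partial>M) * (ennreal (m 1 / l) * ennreal (m 2 / l)) \<partial>count_space UNIV \<partial>count_space UNIV)"
  proof (rule nn_integral_cong, rule nn_integral_cong)
    fix j k
    show "(\<integral>\<^sup>+\<omega>. ?c j k \<omega> * (of_nat (G 1 t j \<omega>) * of_nat (G 2 t k \<omega>)) \<partial>M) =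
        (\<integral>\<^sup>+\<omega>. ?c j k \<omega> \<partial>M) * (ennreal (m 1 / l) * ennreal (m 2 / l))"
      using nn_integral_past_mult_G[OF t, of "\<lambda>x. h x * (c 1 j x * c 2 k x)"
          "\<lambda>w. of_nat (fst (snd w) (1, j)) * of_nat (fst (snd w) (2, k))"]
      by (simp add: nn_integral_G_mult[OF t])
  qed
  also have "\<dots> = (\<integral>\<^sup>+j. \<integral>\<^sup>+k. \<integral>\<^sup>+\<omega>. ?c j k \<omega> \<partial>M \<partial>count_space UNIV \<partial>count_space UNIV) * (ennreal (m 1 / l) * ennreal (m 2 / l))"
    by (simp add: nn_integral_multc)
  also have "(\<integral>\<^sup>+j. \<integral>\<^sup>+k. \<integral>\<^sup>+\<omega>. ?c j k \<omega> \<partial>M \<partial>count_space UNIV \<partial>count_space UNIV) =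
      (\<integral>\<^sup>+\<omega>. \<integral>\<^sup>+j. \<integral>\<^sup>+k. ?c j k \<omega> \<partial>count_space UNIV \<partial>count_space UNIV \<partial>M)"
    by (subst nn_integral_count_space_nn_integral)
       (auto intro!: nn_integral_cong nn_integral_count_space_nn_integral[symmetric] borel_measurable_nn_integral_count_space_nat)
  also have "\<dots> = (\<integral>\<^sup>+\<omega>. h (past t \<omega>) * (of_nat (X 1 (t - 1) \<omega> + 1) * of_nat (X 2 (t - 1) \<omega> + 1)) \<partial>M)"
    unfolding c_past
    by (simp only: of_nat_eq_nn_integral nn_integral_cmult nn_integral_multc borel_measurable_count_space)
  finally show ?thesis by (simp add: mult.commute)
qed

lemma measurable_thinned [measurable]:
  assumes t: "1 \<le> t" shows "thinned i t \<in> measurable M (count_space UNIV)"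
proof -
  note [measurable] = G_measurable[OF t]
  have "(\<lambda>\<omega>. \<Sum>j<X i (t - 1) \<omega> + 1. G i t j \<omega>) \<in> measurable M (count_space UNIV)"
    by (rule measurable_compose_countable[where f="\<lambda>n \<omega>. \<Sum>j<n + 1. G i t j \<omega>"]) measurable
  then show ?thesis unfolding thinned_def nb_op_def[abs_def] .
qed

text \<open>\<open>enn2real\<close> sends infinity to \<open>0\<close>, as the Bochner integral does
  for nonnegative functions that are not integrable, so the identity passes to the reals without a
  side condition on moments.\<close>

lemma expectation_past_mult_thinned:
  assumes t: "1 \<le> t" and h: "h \<in> borel_measurable (past_space t)" and h_nonneg: "\<And>x. 0 \<le> h x"
  shows "expectation (\<lambda>\<omega>. h (past t \<omega>) * real (thinned i t \<omega>)) =
    m i / l * expectation (\<lambda>\<omega>. h (past t \<omega>) * (real (X i (t - 1) \<omega>) + 1))"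
proof -
  note [measurable] = h measurable_thinned[OF t]
  have "expectation (\<lambda>\<omega>. h (past t \<omega>) * real (thinned i t \<omega>)) =
      enn2real (\<integral>\<^sup>+\<omega>. ennreal (h (past t \<omega>)) * of_nat (thinned i t \<omega>) \<partial>M)"
    using h_nonneg by (subst integral_eq_nn_integral) (auto simp: ennreal_mult' ennreal_of_nat_eq_real_of_nat)
  also have "\<dots> = m i / l * enn2real (\<integral>\<^sup>+\<omega>. ennreal (h (past t \<omega>)) * of_nat (X i (t - 1) \<omega> + 1) \<partial>M)"
    using m_bounds[of i] l_gt_1
    by (subst nn_integral_past_mult_thinned[OF t, of "\<lambda>x. ennreal (h x)"]) (auto simp: enn2real_mult)
  also have "enn2real (\<integral>\<^sup>+\<omega>. ennreal (h (past t \<omega>)) * of_nat (X i (t - 1) \<omega> + 1) \<partial>M) =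
      expectation (\<lambda>\<omega>. h (past t \<omega>) * real (X i (t - 1) \<omega> + 1))"
    using h_nonneg by (subst integral_eq_nn_integral) (auto simp: ennreal_mult' ennreal_of_nat_eq_real_of_nat simp del: of_nat_add)
  finally show ?thesis by (simp add: add.commute)
qed

lemma expectation_past_mult_thinned_thinned:
  assumes t: "1 \<le> t" and h: "h \<in> borel_measurable (past_space t)" and h_nonneg: "\<And>x. 0 \<le> h x"
  shows "expectation (\<lambda>\<omega>. h (past t \<omega>) * (real (thinned 1 t \<omega>) * real (thinned 2 t \<omega>))) =
    m 1 / l * (m 2 / l) * expectation (\<lambda>\<omega>. h (past t \<omega>) * ((real (X 1 (t - 1) \<omega>) + 1) * (real (X 2 (t - 1) \<omega>) + 1)))"
proof -
  note [measurable] = h measurable_thinned[OF t]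
  have "expectation (\<lambda>\<omega>. h (past t \<omega>) * (real (thinned 1 t \<omega>) * real (thinned 2 t \<omega>))) =
      enn2real (\<integral>\<^sup>+\<omega>. ennreal (h (past t \<omega>)) * (of_nat (thinned 1 t \<omega>) * of_nat (thinned 2 t \<omega>)) \<partial>M)"
    using h_nonneg by (subst integral_eq_nn_integral) (auto simp: ennreal_mult' ennreal_of_nat_eq_real_of_nat)
  also have "\<dots> = m 1 / l * (m 2 / l) * enn2real (\<integral>\<^sup>+\<omega>. ennreal (h (past t \<omega>)) * (of_nat (X 1 (t - 1) \<omega> + 1) * of_nat (X 2 (t - 1) \<omega> + 1)) \<partial>M)"
    using m_bounds[of 1] m_bounds[of 2] l_gt_1
    by (subst nn_integral_past_mult_thinned_thinned[OF t, of "\<lambda>x. ennreal (h x)"]) (auto simp: enn2real_mult)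
  also have "enn2real (\<integral>\<^sup>+\<omega>. ennreal (h (past t \<omega>)) * (of_nat (X 1 (t - 1) \<omega> + 1) * of_nat (X 2 (t - 1) \<omega> + 1)) \<partial>M) =
      expectation (\<lambda>\<omega>. h (past t \<omega>) * (real (X 1 (t - 1) \<omega> + 1) * real (X 2 (t - 1) \<omega> + 1)))"
    using h_nonneg by (subst integral_eq_nn_integral) (auto simp: ennreal_mult' ennreal_of_nat_eq_real_of_nat simp del: of_nat_add)
  finally show ?thesis by (simp add: add.commute)
qed

end

section \<open>Square-integrable functions and conditional expectations\<close>

context prob_space
begin

definition sq_integrable :: "('a \<Rightarrow> real) \<Rightarrow> bool" where
  "sq_integrable f \<longleftrightarrow> f \<in> borel_measurable M \<and> integrable M (\<lambda>x. (f x)\<^sup>2)"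

lemma sq_integrable_mult: "sq_integrable f \<Longrightarrow> sq_integrable g \<Longrightarrow> integrable M (\<lambda>x. f x * g x)"
  unfolding sq_integrable_def by (intro integrable_mult_square_integrable) auto

lemma sq_integrable_const: "sq_integrable (\<lambda>_. c)"
  by (simp add: sq_integrable_def)

lemma sq_integrable_integrable: "sq_integrable f \<Longrightarrow> integrable M f"
  using sq_integrable_mult[OF _ sq_integrable_const[of 1]] by simp

lemma sq_integrable_add:
  assumes "sq_integrable f" "sq_integrable g"
  shows "sq_integrable (\<lambda>x. f x + g x)"
proof -
  have "integrable M (\<lambda>x. (f x)\<^sup>2 + (g x)\<^sup>2 + 2 * (f x * g x))"
    using assms sq_integrable_mult[OF assms] by (simp add: sq_integrable_def)
  then show ?thesis using assms by (auto simp: sq_integrable_def power2_sum mult.assoc)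
qed

lemma sq_integrable_cmult: "sq_integrable f \<Longrightarrow> sq_integrable (\<lambda>x. c * f x)"
  by (auto simp: sq_integrable_def power_mult_distrib)

lemma sq_integrable_diff: "sq_integrable f \<Longrightarrow> sq_integrable g \<Longrightarrow> sq_integrable (\<lambda>x. f x - g x)"
  using sq_integrable_add[of f "\<lambda>x. - 1 * g x"] sq_integrable_cmult[of g "- 1"] by simp

lemma sq_integrable_bound:
  assumes g: "sq_integrable g" and f: "f \<in> borel_measurable M" and le: "AE x in M. \<bar>f x\<bar> \<le> \<bar>g x\<bar>"
  shows "sq_integrable f"
  unfolding sq_integrable_def
proof
  show "integrable M (\<lambda>x. (f x)\<^sup>2)"
  proof (rule Bochner_Integration.integrable_bound)
    show "integrable M (\<lambda>x. (g x)\<^sup>2)" using g by (simp add: sq_integrable_def)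
    show "AE x in M. norm ((f x)\<^sup>2) \<le> norm ((g x)\<^sup>2)"
      using le by eventually_elim (simp add: abs_le_square_iff)
  qed (use f in auto)
qed (rule f)

text \<open>The events of the generated algebra are the preimages of sets of \<open>N\<close>, so
  testing against \<open>indicator B (f x)\<close> is enough. Applied to the previous state for the
  regression function and to the whole past for the martingale property.\<close>

lemma real_cond_exp_vimage_algebra:
  assumes f: "f \<in> measurable M N" and Y: "integrable M Y" and W: "integrable M W"
    and W_meas: "W \<in> borel_measurable (vimage_algebra (space M) f N)"
    and eq: "\<And>B. B \<in> sets N \<Longrightarrow>
      expectation (\<lambda>x. indicator B (f x) * Y x) = expectation (\<lambda>x. indicator B (f x) * W x)"
  shows "AE x in M. real_cond_exp M (vimage_algebra (space M) f N) Y x = W x"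
proof -
  interpret finite_measure_subalgebra M "vimage_algebra (space M) f N"
    by unfold_locales (rule subalgebra_vimage_algebra[OF f])
  show ?thesis
  proof (rule real_cond_exp_charact[OF _ Y W W_meas])
    fix A assume "A \<in> sets (vimage_algebra (space M) f N)"
    moreover have "f \<in> space M \<rightarrow> space N" using measurable_space[OF f] by auto
    ultimately obtain B where B: "B \<in> sets N" and A: "A = f -` B \<inter> space M"
      by (auto simp: sets_vimage_algebra2)
    have "(\<integral>x\<in>A. V x \<partial>M) = expectation (\<lambda>x. indicator B (f x) * V x)" for V :: "'a \<Rightarrow> real"
      unfolding set_lebesgue_integral_def A
      by (intro Bochner_Integration.integral_cong) (auto simp: indicator_def)
    then show "(\<integral>x\<in>A. Y x \<partial>M) = (\<integral>x\<in>A. W x \<partial>M)" using eq[OF B] by simp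
  qed
qed

end

section \<open>The martingale difference property\<close>

context brcmnbinar
begin

definition resid :: "2 \<Rightarrow> nat \<Rightarrow> 'a \<Rightarrow> real" where
  "resid i t \<omega> = real (X i t \<omega>) - m i * (real (X i (t - 1) \<omega>) + 1) / l - \<mu> i"

text \<open>Despite the name this is the martingale difference \<open>\<epsilon>\<close>, not the
  noise \<open>Z\<close> of the recursion.\<close>

definition innov :: "nat \<Rightarrow> 'a \<Rightarrow> real" where
  "innov t \<omega> = resid 1 t \<omega> * resid 2 t \<omega> - \<phi>"

lemma AE_X_eq: "1 \<le> t \<Longrightarrow> AE \<omega> in M. X i t \<omega> = thinned i t \<omega> + Z i t \<omega>"
  using recursion[of t i] by (simp add: thinned_def)

text \<open>Joint independence of the noise from thinned parts and past is what removes the mixed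
  terms, whose second factor involves both.\<close>

lemma expectation_innovation_mult:
  assumes t: "1 \<le> t"
    and u: "u \<in> borel_measurable (count_space UNIV)" and u_int: "integrable M (\<lambda>\<omega>. u (both Z t \<omega>))"
    and v: "v \<in> borel_measurable (count_space UNIV \<Otimes>\<^sub>M past_space t)"
    and v_int: "integrable M (\<lambda>\<omega>. v ((thinned 1 t \<omega>, thinned 2 t \<omega>), past t \<omega>))"
  shows "expectation (\<lambda>\<omega>. u (both Z t \<omega>) * v ((thinned 1 t \<omega>, thinned 2 t \<omega>), past t \<omega>)) =
    expectation (\<lambda>\<omega>. u (both Z t \<omega>)) * expectation (\<lambda>\<omega>. v ((thinned 1 t \<omega>, thinned 2 t \<omega>), past t \<omega>) :: real)"
  using indep_var_lebesgue_integral[OF indep_rv_compose[OF Z_indep_thinned_past[OF t] u v], folded thinned_def past_def, OF u_int v_int] .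

end

locale brcmnbinar_fourth_moments = brcmnbinar +
  assumes fourth_moments: "\<And>i t. integrable M (\<lambda>\<omega>. \<bar>real (X i t \<omega>)\<bar> ^ 4)"
begin

lemma sq_integrable_X_squared: "sq_integrable (\<lambda>\<omega>. (real (X i t \<omega>))\<^sup>2)"
  using fourth_moments[of i t] by (simp add: sq_integrable_def)

lemma sq_integrable_X: "sq_integrable (\<lambda>\<omega>. real (X i t \<omega>))"
  using sq_integrable_integrable[OF sq_integrable_X_squared[of i t]] by (simp add: sq_integrable_def)

lemma sq_integrable_Z: "1 \<le> t \<Longrightarrow> sq_integrable (\<lambda>\<omega>. real (Z i t \<omega>))"
  using Z_square_integrable[of t i] measurable_compose[OF Z_measurable[of t i], of real borel]
  by (simp add: sq_integrable_def)

text \<open>Since the noise is nonnegative, the thinned part is dominated by \<open>X\<close>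
  itself; this replaces a computation of second moments of the mixture.\<close>

lemma sq_integrable_thinned:
  assumes t: "1 \<le> t" shows "sq_integrable (\<lambda>\<omega>. real (thinned i t \<omega>))"
proof (rule sq_integrable_bound[OF sq_integrable_X[of i t]])
  show "(\<lambda>\<omega>. real (thinned i t \<omega>)) \<in> borel_measurable M"
    using measurable_thinned[OF t] by measurable
  show "AE \<omega> in M. \<bar>real (thinned i t \<omega>)\<bar> \<le> \<bar>real (X i t \<omega>)\<bar>"
    using AE_X_eq[OF t, of i] by eventually_elim simp
qed

lemma sq_integrable_resid: "sq_integrable (resid i t)"
proof -
  have "sq_integrable (\<lambda>\<omega>. real (X i t \<omega>) - (m i / l) * (real (X i (t - 1) \<omega>) + 1) - \<mu> i)"
    by (intro sq_integrable_diff sq_integrable_add sq_integrable_cmult sq_integrable_X sq_integrable_const)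
  then show ?thesis by (simp add: resid_def[abs_def])
qed

text \<open>Expanding the square leaves products of two values of the process, and these are square
  integrable precisely by the fourth moments.\<close>

lemma sq_integrable_resid_squared: "sq_integrable (\<lambda>\<omega>. (resid i t \<omega>)\<^sup>2)"
proof -
  have X_mult: "sq_integrable (\<lambda>\<omega>. real (X i s \<omega>) * real (X i t \<omega>))" for s t
    using sq_integrable_mult[OF sq_integrable_X_squared[of i s] sq_integrable_X_squared[of i t]]
    by (simp add: sq_integrable_def power_mult_distrib)
  define a where "a = m i / l"
  define c where "c = a + \<mu> i"
  let ?q = "\<lambda>\<omega>. real (X i t \<omega>) * real (X i t \<omega>) + a\<^sup>2 * (real (X i (t - 1) \<omega>) * real (X i (t - 1) \<omega>)) + c\<^sup>2
      - 2 * a * (real (X i t \<omega>) * real (X i (t - 1) \<omega>)) - 2 * c * real (X i t \<omega>) + 2 * a * c * real (X i (t - 1) \<omega>)"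
  have "sq_integrable ?q"
    by (intro sq_integrable_diff sq_integrable_add sq_integrable_cmult X_mult sq_integrable_X sq_integrable_const)
  moreover have "(resid i t \<omega>)\<^sup>2 = ?q \<omega>" for \<omega>
  proof -
    have r: "resid i t \<omega> = real (X i t \<omega>) - a * real (X i (t - 1) \<omega>) - c"
      by (simp add: resid_def a_def c_def algebra_simps add_divide_distrib)
    show ?thesis unfolding r power2_eq_square by (simp add: algebra_simps)
  qed
  ultimately show ?thesis by simp
qed

lemma sq_integrable_innov: "sq_integrable (innov t)"
proof -
  have "sq_integrable (\<lambda>\<omega>. resid 1 t \<omega> * resid 2 t \<omega>)"
    using sq_integrable_mult[OF sq_integrable_resid_squared[of 1 t] sq_integrable_resid_squared[of 2 t]]
      sq_integrable_resid[of 1 t] sq_integrable_resid[of 2 t]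
    by (auto simp: sq_integrable_def power_mult_distrib)
  then show ?thesis
    unfolding innov_def[abs_def] by (intro sq_integrable_diff sq_integrable_const)
qed

text \<open>A residual is a thinning error \<open>T i - a i * N i\<close> plus a noise error
  \<open>U i\<close>. In the product of two residuals, the thinning errors are uncorrelated given
  the past, the mixed terms vanish because \<open>U\<close> is centred and independent of the rest,
  and the noise errors contribute \<open>\<phi>\<close>. The lower bound on \<open>h\<close> gives
  access to the nonnegative integrals, the upper bound to integrability.\<close>

lemma
  assumes t: "1 \<le> t" and h [measurable]: "h \<in> borel_measurable (past_space t)"
    and h_bounds: "\<And>x. 0 \<le> h x" "\<And>x. h x \<le> 1"
  shows expectation_past_mult_resid: "expectation (\<lambda>\<omega>. h (past t \<omega>) * resid i t \<omega>) = 0"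
    and expectation_past_mult_innov: "expectation (\<lambda>\<omega>. h (past t \<omega>) * innov t \<omega>) = 0"
proof -
  define H where "H \<omega> = h (past t \<omega>)" for \<omega>
  define T where "T i \<omega> = real (thinned i t \<omega>)" for i \<omega>
  define N where "N i \<omega> = real (X i (t - 1) \<omega>) + 1" for i \<omega>
  define U where "U i \<omega> = real (Z i t \<omega>) - \<mu> i" for i \<omega>
  define a where "a i = m i / l" for i
  note [measurable] = measurable_thinned[OF t]
  have [measurable]: "H \<in> borel_measurable M" unfolding H_def by measurable
  have H: "\<bar>H \<omega>\<bar> \<le> 1" for \<omega> using h_bounds by (simp add: H_def)
  have T: "sq_integrable (T i)" for i unfolding T_def by (rule sq_integrable_thinned[OF t])
  have N: "sq_integrable (N i)" for i
    unfolding N_def by (intro sq_integrable_add sq_integrable_X sq_integrable_const)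
  have U: "sq_integrable (U i)" for i
    unfolding U_def by (intro sq_integrable_diff sq_integrable_Z[OF t] sq_integrable_const)
  have H_mult: "sq_integrable (\<lambda>\<omega>. H \<omega> * V \<omega>)" if V: "sq_integrable V" for V
  proof (rule sq_integrable_bound[OF V])
    have [measurable]: "V \<in> borel_measurable M" using V by (simp add: sq_integrable_def)
    show "(\<lambda>\<omega>. H \<omega> * V \<omega>) \<in> borel_measurable M" by measurable
    show "AE \<omega> in M. \<bar>H \<omega> * V \<omega>\<bar> \<le> \<bar>V \<omega>\<bar>"
      using H by (intro AE_I2) (simp add: abs_mult mult_left_le_one_le)
  qed
  have H_int: "integrable M (\<lambda>\<omega>. H \<omega> * V \<omega>)" if "sq_integrable V" for V
    using sq_integrable_integrable[OF H_mult[OF that]] .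
  have H_int2: "integrable M (\<lambda>\<omega>. H \<omega> * (V \<omega> * W \<omega>))" if "sq_integrable V" "sq_integrable W" for V W
    using sq_integrable_mult[OF H_mult[OF that(1)] that(2)] by (simp add: mult.assoc)
  have D: "sq_integrable (\<lambda>\<omega>. T i \<omega> - a i * N i \<omega>)" for i
    by (intro sq_integrable_diff sq_integrable_cmult T N)
  have U_mean: "expectation (U i) = 0" for i
    using sq_integrable_integrable[OF sq_integrable_Z[OF t, of i]] Z_mean[OF t, of i]
    by (simp add: U_def[abs_def] prob_space)
  have component_meas: "(\<lambda>x. real (component i (x (t - 1)))) \<in> borel_measurable (past_space t)" for i
    by (rule measurable_compose[OF measurable_past_component]) (use t in auto)
  have T_H: "expectation (\<lambda>\<omega>. H \<omega> * T i \<omega>) = a i * expectation (\<lambda>\<omega>. H \<omega> * N i \<omega>)" for i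
    unfolding H_def T_def N_def a_def by (rule expectation_past_mult_thinned[OF t h h_bounds(1)])
  \<comment> \<open>A nonnegative function of the past remains one after multiplication by
    \<open>N j\<close>, so the mixed product reduces to the identity for a single thinning.\<close>
  have T_HN: "expectation (\<lambda>\<omega>. H \<omega> * (N j \<omega> * T i \<omega>)) = a i * expectation (\<lambda>\<omega>. H \<omega> * (N j \<omega> * N i \<omega>))" for i j
  proof -
    note [measurable] = component_meas[of j]
    have "(\<lambda>x. h x * (real (component j (x (t - 1))) + 1)) \<in> borel_measurable (past_space t)"
      by measurable
    from expectation_past_mult_thinned[OF t this, of i] show ?thesis
      using t h_bounds(1) by (simp add: H_def N_def T_def a_def component_past mult.assoc)
  qed
  have T_T: "expectation (\<lambda>\<omega>. H \<omega> * (T 1 \<omega> * T 2 \<omega>)) = a 1 * a 2 * expectation (\<lambda>\<omega>. H \<omega> * (N 1 \<omega> * N 2 \<omega>))"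
    unfolding H_def T_def N_def a_def by (rule expectation_past_mult_thinned_thinned[OF t h h_bounds(1)])
  have H_D: "expectation (\<lambda>\<omega>. H \<omega> * (T i \<omega> - a i * N i \<omega>)) = 0" for i
  proof -
    have "expectation (\<lambda>\<omega>. H \<omega> * (T i \<omega> - a i * N i \<omega>)) =
        expectation (\<lambda>\<omega>. H \<omega> * T i \<omega> - a i * (H \<omega> * N i \<omega>))"
      by (simp add: algebra_simps)
    then show ?thesis using H_int[OF T, of i] H_int[OF N, of i] T_H by simp
  qed
  have H_DD: "expectation (\<lambda>\<omega>. H \<omega> * ((T 1 \<omega> - a 1 * N 1 \<omega>) * (T 2 \<omega> - a 2 * N 2 \<omega>))) = 0"
  proof -
    have "expectation (\<lambda>\<omega>. H \<omega> * ((T 1 \<omega> - a 1 * N 1 \<omega>) * (T 2 \<omega> - a 2 * N 2 \<omega>))) =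
        expectation (\<lambda>\<omega>. H \<omega> * (T 1 \<omega> * T 2 \<omega>) - a 2 * (H \<omega> * (N 2 \<omega> * T 1 \<omega>))
          - a 1 * (H \<omega> * (N 1 \<omega> * T 2 \<omega>)) + a 1 * a 2 * (H \<omega> * (N 1 \<omega> * N 2 \<omega>)))"
      by (simp add: algebra_simps)
    \<comment> \<open>All four terms are now multiples of the same expectation and cancel in
      pairs.\<close>
    also have "\<dots> = a 1 * a 2 * expectation (\<lambda>\<omega>. H \<omega> * (N 1 \<omega> * N 2 \<omega>)) - a 2 * (a 1 * expectation (\<lambda>\<omega>. H \<omega> * (N 2 \<omega> * N 1 \<omega>)))
        - a 1 * (a 2 * expectation (\<lambda>\<omega>. H \<omega> * (N 1 \<omega> * N 2 \<omega>))) + a 1 * a 2 * expectation (\<lambda>\<omega>. H \<omega> * (N 1 \<omega> * N 2 \<omega>))"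
      using H_int2[OF T T] H_int2[OF N T] H_int2[OF N N] by (simp add: T_HN T_T)
    also have "\<dots> = 0" by (simp add: mult.commute[of "N 2 _"])
    finally show ?thesis .
  qed
  have H_Z: "expectation (\<lambda>\<omega>. u (both Z t \<omega>) * H \<omega>) = expectation (\<lambda>\<omega>. u (both Z t \<omega>)) * expectation H"
    if "integrable M (\<lambda>\<omega>. u (both Z t \<omega>))" for u :: "nat \<times> nat \<Rightarrow> real"
    using expectation_innovation_mult[OF t _ that, of "\<lambda>w. h (snd w)"] H_int[OF sq_integrable_const[of 1]]
    by (simp add: H_def[abs_def])
  have H_U: "expectation (\<lambda>\<omega>. H \<omega> * U i \<omega>) = 0" for i
    using H_Z[of "\<lambda>z. real (component i z) - \<mu> i"] sq_integrable_integrable[OF U[of i]] U_mean[of i]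
    by (simp add: U_def[abs_def] mult.commute)
  have H_UU: "expectation (\<lambda>\<omega>. H \<omega> * (U 1 \<omega> * U 2 \<omega>)) = \<phi> * expectation H"
    using H_Z[of "\<lambda>z. (real (component 1 z) - \<mu> 1) * (real (component 2 z) - \<mu> 2)"] sq_integrable_mult[OF U[of 1] U[of 2]]
      Z_covariance[OF t]
    by (simp add: U_def[abs_def] mult.commute)
  have H_UD: "expectation (\<lambda>\<omega>. H \<omega> * (U j \<omega> * (T i \<omega> - a i * N i \<omega>))) = 0" for i j
  proof -
    have T_eq: "component i (thinned 1 t \<omega>, thinned 2 t \<omega>) = thinned i t \<omega>" for \<omega>
      using exhaust_2[of i] by (auto simp: component_def)
    have N_eq: "real (component i (past t \<omega> (t - 1))) + 1 = N i \<omega>" for \<omega>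
      using t by (simp add: component_past N_def)
    \<comment> \<open>Weight, previous state and thinned part are packed into one function of the
      pair that is independent of the noise, so that the centred \<open>U j\<close> factors
      out.\<close>
    define v where "v w = h (snd w) * (real (component i (fst w)) - a i * (real (component i (snd w (t - 1))) + 1))"
      for w :: "(nat \<times> nat) \<times> (nat \<Rightarrow> nat \<times> nat)"
    have v_eq: "v ((thinned 1 t \<omega>, thinned 2 t \<omega>), past t \<omega>) = H \<omega> * (T i \<omega> - a i * N i \<omega>)" for \<omega>
      by (simp only: v_def fst_conv snd_conv T_eq N_eq H_def T_def)
    note [measurable] = measurable_compose[OF measurable_snd component_meas[of i]]
    have "v \<in> borel_measurable (count_space UNIV \<Otimes>\<^sub>M past_space t)"
      unfolding v_def by measurable
    from expectation_innovation_mult[OF t _ _ this, of "\<lambda>z. real (component j z) - \<mu> j"]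
    have "expectation (\<lambda>\<omega>. U j \<omega> * (H \<omega> * (T i \<omega> - a i * N i \<omega>))) =
        expectation (U j) * expectation (\<lambda>\<omega>. H \<omega> * (T i \<omega> - a i * N i \<omega>))"
      using sq_integrable_integrable[OF U[of j]] H_int[OF D[of i]] by (simp add: v_eq U_def[abs_def])
    then show ?thesis by (simp add: U_mean mult.left_commute)
  qed
  have resid_eq: "AE \<omega> in M. resid i t \<omega> = (T i \<omega> - a i * N i \<omega>) + U i \<omega>" for i
    using AE_X_eq[OF t, of i]
    by eventually_elim (simp add: resid_def T_def N_def U_def a_def)
  have resid_meas [measurable]: "resid i t \<in> borel_measurable M" for i
    using sq_integrable_resid by (simp add: sq_integrable_def)
  have [measurable]: "T i \<in> borel_measurable M" "N i \<in> borel_measurable M" "U i \<in> borel_measurable M" for i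
    using T N U by (auto simp: sq_integrable_def)
  have "expectation (\<lambda>\<omega>. H \<omega> * resid i t \<omega>) =
      expectation (\<lambda>\<omega>. H \<omega> * (T i \<omega> - a i * N i \<omega>) + H \<omega> * U i \<omega>)"
  proof (rule integral_cong_AE)
    show "AE \<omega> in M. H \<omega> * resid i t \<omega> = H \<omega> * (T i \<omega> - a i * N i \<omega>) + H \<omega> * U i \<omega>"
      using resid_eq[of i] by eventually_elim (simp only: distrib_left)
  qed measurable
  also have "\<dots> = 0" using H_int[OF D] H_int[OF U] H_D H_U by simp
  finally show "expectation (\<lambda>\<omega>. h (past t \<omega>) * resid i t \<omega>) = 0" by (simp add: H_def)
  have [measurable]: "innov t \<in> borel_measurable M" using sq_integrable_innov by (simp add: sq_integrable_def)
  let ?D = "\<lambda>i \<omega>. T i \<omega> - a i * N i \<omega>"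
  have "expectation (\<lambda>\<omega>. H \<omega> * innov t \<omega>) =
      expectation (\<lambda>\<omega>. H \<omega> * (?D 1 \<omega> * ?D 2 \<omega>) + H \<omega> * (U 2 \<omega> * ?D 1 \<omega>) + H \<omega> * (U 1 \<omega> * ?D 2 \<omega>)
        + H \<omega> * (U 1 \<omega> * U 2 \<omega>) - H \<omega> * \<phi>)"
  proof (rule integral_cong_AE)
    show "AE \<omega> in M. H \<omega> * innov t \<omega> = H \<omega> * (?D 1 \<omega> * ?D 2 \<omega>) + H \<omega> * (U 2 \<omega> * ?D 1 \<omega>) + H \<omega> * (U 1 \<omega> * ?D 2 \<omega>)
        + H \<omega> * (U 1 \<omega> * U 2 \<omega>) - H \<omega> * \<phi>"
      using resid_eq[of 1] resid_eq[of 2]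
    proof eventually_elim
      case (elim \<omega>)
      have "H \<omega> * innov t \<omega> = H \<omega> * ((?D 1 \<omega> + U 1 \<omega>) * (?D 2 \<omega> + U 2 \<omega>) - \<phi>)"
        unfolding innov_def elim ..
      then show ?case by (simp add: algebra_simps)
    qed
  qed measurable
  also have "\<dots> = 0"
    using H_int2[OF D D, of 1 2] H_int2[OF U D, of 2 1] H_int2[OF U D, of 1 2] H_int2[OF U U, of 1 2]
      H_int[OF sq_integrable_const[of \<phi>]] H_DD H_UD[of 2 1] H_UD[of 1 2] H_UU
    by simp
  finally show "expectation (\<lambda>\<omega>. h (past t \<omega>) * innov t \<omega>) = 0" by (simp add: H_def)
qed

end

section \<open>The estimator\<close>

text \<open>\<open>arg_min\<close> is a choice among minimizers, so uniqueness has to be shown as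
  well; completing the square gives both.\<close>

lemma arg_min_sum_squares:
  fixes y :: "'i \<Rightarrow> real"
  assumes A: "finite A" "A \<noteq> {}"
  shows "arg_min (\<lambda>p. \<Sum>t\<in>A. (y t - p)\<^sup>2) (\<lambda>_. True) = (\<Sum>t\<in>A. y t) / card A"
proof -
  define c where "c = (\<Sum>t\<in>A. y t) / card A"
  have card: "0 < card A" using A by (simp add: card_gt_0_iff)
  have split: "(\<Sum>t\<in>A. (y t - p)\<^sup>2) = (\<Sum>t\<in>A. (y t - c)\<^sup>2) + card A * (p - c)\<^sup>2" for p
  proof -
    define e where "e t = y t - c" for t
    have "(\<Sum>t\<in>A. (y t - p)\<^sup>2) = (\<Sum>t\<in>A. (e t)\<^sup>2 + (p - c)\<^sup>2 - 2 * (p - c) * e t)"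
      by (intro sum.cong refl) (simp add: e_def power2_eq_square algebra_simps)
    also have "\<dots> = (\<Sum>t\<in>A. (e t)\<^sup>2) + card A * (p - c)\<^sup>2 - 2 * (p - c) * (\<Sum>t\<in>A. e t)"
      by (simp add: sum.distrib sum_subtractf sum_distrib_left)
    also have "(\<Sum>t\<in>A. e t) = 0" using card by (simp add: e_def sum_subtractf c_def)
    finally show ?thesis by (simp add: e_def)
  qed
  have "is_arg_min (\<lambda>p. \<Sum>t\<in>A. (y t - p)\<^sup>2) (\<lambda>_. True) p \<longleftrightarrow> p = c" for p
  proof
    assume "is_arg_min (\<lambda>p. \<Sum>t\<in>A. (y t - p)\<^sup>2) (\<lambda>_. True) p"
    then have "\<not> (\<Sum>t\<in>A. (y t - c)\<^sup>2) < (\<Sum>t\<in>A. (y t - p)\<^sup>2)" by (auto simp: is_arg_min_def)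
    then have "card A * (p - c)\<^sup>2 \<le> 0" unfolding split[of p] by simp
    then show "p = c" using card by (simp add: mult_le_0_iff)
  next
    assume "p = c"
    moreover have "(\<Sum>t\<in>A. (y t - c)\<^sup>2) \<le> (\<Sum>t\<in>A. (y t - q)\<^sup>2)" for q
      unfolding split[of q] by simp
    ultimately show "is_arg_min (\<lambda>p. \<Sum>t\<in>A. (y t - p)\<^sup>2) (\<lambda>_. True) p"
      by (simp add: is_arg_min_def not_less)
  qed
  then show ?thesis by (simp add: arg_min_def c_def)
qed

text \<open>The estimator from \<open>n\<close> observations averages \<open>n - 1\<close> residual
  products, which shifts the index by one; the laws at small \<open>n\<close> are irrelevant to the
  limit.\<close>

lemma weak_conv_m_Suc_cong:
  assumes lim: "weak_conv_m \<mu> \<nu>" and eq: "\<And>n. 0 < n \<Longrightarrow> \<mu>' (Suc n) = \<mu> n"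
  shows "weak_conv_m \<mu>' \<nu>"
  unfolding weak_conv_m_def weak_conv_def
proof (intro allI impI)
  fix x assume "isCont (cdf \<nu>) x"
  then have "(\<lambda>n. cdf (\<mu> n) x) \<longlonglongrightarrow> cdf \<nu> x"
    using lim by (simp add: weak_conv_m_def weak_conv_def)
  moreover have "eventually (\<lambda>n. cdf (\<mu> n) x = cdf (\<mu>' (Suc n)) x) sequentially"
    using eventually_gt_at_top[of 0] by eventually_elim (simp add: eq)
  ultimately have "(\<lambda>n. cdf (\<mu>' (Suc n)) x) \<longlonglongrightarrow> cdf \<nu> x"
    by (rule Lim_transform_eventually)
  then show "(\<lambda>n. cdf (\<mu>' n) x) \<longlonglongrightarrow> cdf \<nu> x" by (rule LIMSEQ_imp_Suc)
qed

section \<open>Transfer to the path space\<close>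

definition path_shift :: "(nat \<Rightarrow> 'b) \<Rightarrow> nat \<Rightarrow> 'b" where
  "path_shift x = (\<lambda>t. x (Suc t))"

lemma funpow_path_shift: "(path_shift ^^ k) x = (\<lambda>t. x (t + k))"
  by (induction k) (auto simp: path_shift_def)

lemma measurable_path_shift [measurable]:
  "path_shift \<in> measurable (Pi\<^sub>M UNIV (\<lambda>_. S)) (Pi\<^sub>M UNIV (\<lambda>_. S))"
  unfolding path_shift_def by (intro measurable_PiM_single') (auto simp: space_PiM)

text \<open>The sample space carries no shift. On the path law, stationarity says that the shift
  preserves the measure and ergodicity that its invariant events are trivial, so Birkhoff's theorem
  applies there and is pulled back.\<close>

lemma (in prob_space) ergodic_process_averages:
  fixes Y :: "nat \<Rightarrow> 'a \<Rightarrow> 'b" and g :: "(nat \<Rightarrow> 'b) \<Rightarrow> real"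
  assumes Y: "\<And>t. Y t \<in> measurable M S"
    and stat: "strictly_stationary M S Y" and erg: "ergodic_process M S Y"
    and g: "g \<in> borel_measurable (Pi\<^sub>M UNIV (\<lambda>_. S))"
    and int: "integrable M (\<lambda>\<omega>. g (\<lambda>t. Y t \<omega>))"
  shows "AE \<omega> in M. (\<lambda>n. (\<Sum>k<n. g (\<lambda>t. Y (t + k) \<omega>)) / n) \<longlonglongrightarrow> expectation (\<lambda>\<omega>. g (\<lambda>t. Y t \<omega>))"
proof -
  let ?P = "Pi\<^sub>M UNIV (\<lambda>_. S)"
  define path where "path = (\<lambda>\<omega> t. Y t \<omega>)"
  define Q where "Q = distr M ?P path"
  have path [measurable]: "path \<in> measurable M ?P"
    unfolding path_def using Y measurable_space[OF Y]
    by (intro measurable_PiM_single') (auto simp: space_PiM)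
  have Q_sets [measurable_cong]: "sets Q = sets ?P" by (simp add: Q_def)
  interpret Q: prob_space Q unfolding Q_def by (rule prob_space_distr) measurable
  have "AE x in Q. (\<lambda>n. (\<Sum>k<n. g ((path_shift ^^ k) x)) / n) \<longlonglongrightarrow> Q.expectation g"
  proof (rule Q.birkhoff_ergodic)
    show "path_shift \<in> measurable Q Q" by measurable
    have "distr Q Q path_shift = distr Q ?P path_shift"
      by (rule distr_cong) (simp_all add: Q_sets)
    also have "\<dots> = distr M ?P (path_shift \<circ> path)"
      unfolding Q_def by (rule distr_distr[OF measurable_path_shift path])
    also have "\<dots> = distr M ?P (\<lambda>\<omega> t. Y (t + 1) \<omega>)"
      by (simp add: comp_def path_shift_def path_def)
    also have "\<dots> = Q" using stat unfolding strictly_stationary_def Q_def path_def by blast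
    finally show "distr Q Q path_shift = Q" .
    show "Q.prob A \<in> {0, 1}" if A: "A \<in> sets Q" and inv: "path_shift -` A \<inter> space Q = A" for A
    proof -
      have "{x \<in> space ?P. (\<lambda>t. x (Suc t)) \<in> A} = A"
        using inv by (auto simp: Q_def path_shift_def)
      then have "prob {\<omega> \<in> space M. (\<lambda>t. Y t \<omega>) \<in> A} \<in> {0, 1}"
        using erg A by (auto simp: ergodic_process_def Q_def)
      moreover have "Q.prob A = prob (path -` A \<inter> space M)"
        using A unfolding Q_def by (intro measure_distr path) simp
      moreover have "path -` A \<inter> space M = {\<omega> \<in> space M. (\<lambda>t. Y t \<omega>) \<in> A}"
        by (auto simp: path_def)
      ultimately show ?thesis by simp
    qed
    show "integrable Q g"
      unfolding Q_def integrable_distr_eq[OF path g] using int by (simp add: path_def)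
  qed
  then have "AE \<omega> in M. (\<lambda>n. (\<Sum>k<n. g ((path_shift ^^ k) (path \<omega>))) / n) \<longlonglongrightarrow> Q.expectation g"
    unfolding Q_def by (rule AE_distrD[OF path])
  moreover have "Q.expectation g = expectation (\<lambda>\<omega>. g (\<lambda>t. Y t \<omega>))"
    unfolding Q_def integral_distr[OF path g] by (simp add: path_def)
  ultimately show ?thesis by (simp add: funpow_path_shift path_def)
qed

lemma (in prob_space) strictly_stationary_expectation:
  fixes Y :: "nat \<Rightarrow> 'a \<Rightarrow> 'b" and g :: "(nat \<Rightarrow> 'b) \<Rightarrow> real"
  assumes Y: "\<And>t. Y t \<in> measurable M S"
    and stat: "strictly_stationary M S Y"
    and g: "g \<in> borel_measurable (Pi\<^sub>M UNIV (\<lambda>_. S))"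
  shows "expectation (\<lambda>\<omega>. g (\<lambda>t. Y (t + h) \<omega>)) = expectation (\<lambda>\<omega>. g (\<lambda>t. Y t \<omega>))"
proof -
  let ?P = "Pi\<^sub>M UNIV (\<lambda>_. S)"
  have path: "(\<lambda>\<omega> t. Y (t + h) \<omega>) \<in> measurable M ?P" for h
    using Y measurable_space[OF Y] by (intro measurable_PiM_single') (auto simp: space_PiM)
  have "expectation (\<lambda>\<omega>. g (\<lambda>t. Y (t + h) \<omega>)) = integral\<^sup>L (distr M ?P (\<lambda>\<omega> t. Y (t + h) \<omega>)) g"
    by (rule integral_distr[symmetric, OF path g])
  also have "distr M ?P (\<lambda>\<omega> t. Y (t + h) \<omega>) = distr M ?P (\<lambda>\<omega> t. Y t \<omega>)"
    using stat unfolding strictly_stationary_def by blast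
  also have "integral\<^sup>L (distr M ?P (\<lambda>\<omega> t. Y t \<omega>)) g = expectation (\<lambda>\<omega>. g (\<lambda>t. Y t \<omega>))"
    using integral_distr[OF path[of 0] g] by simp
  finally show ?thesis .
qed

section \<open>Asymptotics of the estimator for the process\<close>

context brcmnbinar_fourth_moments
begin

text \<open>Conditioning is on the previous state only; indicators of that state are particular
  functions of the past, to which the residual is orthogonal.\<close>

lemma AE_cond_mean_eq:
  assumes t: "1 \<le> t"
  shows "AE \<omega> in M. cond_mean M X i t \<omega> = m i * (real (X i (t - 1) \<omega>) + 1) / l + \<mu> i"
  unfolding cond_mean_def
proof (rule real_cond_exp_vimage_algebra)
  let ?W = "\<lambda>\<omega>. m i * (real (X i (t - 1) \<omega>) + 1) / l + \<mu> i"
  have X_int: "integrable M (\<lambda>\<omega>. real (X i s \<omega>))" for s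
    by (rule sq_integrable_integrable[OF sq_integrable_X])
  show "integrable M (\<lambda>\<omega>. real (X i t \<omega>))" "integrable M ?W" using X_int by auto
  have "(\<lambda>\<omega>. (\<lambda>z. m i * (real (component i z) + 1) / l + \<mu> i) (both X (t - 1) \<omega>)) \<in>
      borel_measurable (vimage_algebra (space M) (both X (t - 1)) (count_space UNIV))"
    by (rule measurable_compose[OF measurable_vimage_algebra1]) auto
  then show "?W \<in> borel_measurable (vimage_algebra (space M) (both X (t - 1)) (count_space UNIV))"
    by simp
  fix B :: "(nat \<times> nat) set"
  have h: "(\<lambda>x. indicator B (x (t - 1)) :: real) \<in> borel_measurable (past_space t)"
    by (rule measurable_compose[OF measurable_component_singleton[of "t - 1" "{..<t}" "\<lambda>_. count_space UNIV"]])
       (use t in auto)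
  have "expectation (\<lambda>\<omega>. indicator B (past t \<omega> (t - 1)) * resid i t \<omega>) = 0"
    by (rule expectation_past_mult_resid[OF t h]) (auto simp: indicator_def)
  moreover have "past t \<omega> (t - 1) = both X (t - 1) \<omega>" for \<omega> using t by (simp add: past_def)
  moreover have "indicator B (both X (t - 1) \<omega>) * resid i t \<omega> =
      indicator B (both X (t - 1) \<omega>) * real (X i t \<omega>) - indicator B (both X (t - 1) \<omega>) * ?W \<omega>" for \<omega>
    by (simp add: resid_def algebra_simps)
  ultimately have 0: "expectation (\<lambda>\<omega>. indicator B (both X (t - 1) \<omega>) * real (X i t \<omega>) -
      indicator B (both X (t - 1) \<omega>) * ?W \<omega>) = 0" by simp
  have ind: "integrable M (\<lambda>\<omega>. indicator B (both X (t - 1) \<omega>) * V \<omega>)" if "integrable M V" for V :: "'a \<Rightarrow> real"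
  proof (rule Bochner_Integration.integrable_bound[OF that])
    have [measurable]: "(\<lambda>\<omega>. indicator B (both X (t - 1) \<omega>) :: real) \<in> borel_measurable M"
      by (rule measurable_compose[OF measurable_both_X]) simp
    note [measurable] = borel_measurable_integrable[OF that]
    show "(\<lambda>\<omega>. indicator B (both X (t - 1) \<omega>) * V \<omega>) \<in> borel_measurable M" by measurable
  qed (auto simp: indicator_def)
  show "expectation (\<lambda>\<omega>. indicator B (both X (t - 1) \<omega>) * real (X i t \<omega>)) =
      expectation (\<lambda>\<omega>. indicator B (both X (t - 1) \<omega>) * ?W \<omega>)"
    using 0 by (subst (asm) Bochner_Integration.integral_diff) (use ind X_int in auto)
qed measurable

definition past_algebra :: "nat \<Rightarrow> 'a measure" where
  "past_algebra t = vimage_algebra (space M) (past t) (past_space t)"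

lemma measurable_both_X_past_algebra: "s < t \<Longrightarrow> both X s \<in> measurable (past_algebra t) (count_space UNIV)"
proof -
  assume s: "s < t"
  have "past t \<in> measurable (past_algebra t) (past_space t)"
    unfolding past_algebra_def
    by (rule measurable_vimage_algebra1) (use measurable_space[OF measurable_past] in auto)
  from measurable_compose[OF this measurable_component_singleton[of s "{..<t}" "\<lambda>_. count_space UNIV"]]
  show ?thesis using s by (simp add: past_def)
qed

text \<open>The sum defining the estimator starts at time \<open>2\<close>, hence the offset.
  \<open>innov (s + 2)\<close> involves the process up to time \<open>s + 2\<close>, which for
  \<open>s < t\<close> lies strictly before \<open>t + 2\<close>.\<close>

sublocale innov: martingale_differences M "\<lambda>k. past_algebra (k + 2)" "\<lambda>k. innov (k + 2)"
proof
  show "subalgebra M (past_algebra (t + 2))" for t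
    unfolding past_algebra_def by (rule subalgebra_vimage_algebra) measurable
  show "integrable M (\<lambda>x. (innov (t + 2) x)\<^sup>2)" for t
    using sq_integrable_innov by (simp add: sq_integrable_def)
  show "AE x in M. real_cond_exp M (past_algebra (t + 2)) (innov (t + 2)) x = 0" for t
    unfolding past_algebra_def
  proof (rule real_cond_exp_vimage_algebra)
    show "integrable M (innov (t + 2))" by (rule sq_integrable_integrable[OF sq_integrable_innov])
    show "expectation (\<lambda>x. indicator B (past (t + 2) x) * innov (t + 2) x) =
        expectation (\<lambda>x. indicator B (past (t + 2) x) * 0)" if "B \<in> sets (past_space (t + 2))" for B
      using expectation_past_mult_innov[of "t + 2" "indicator B"] that by (simp add: indicator_def)
  qed auto
  show "innov (s + 2) \<in> borel_measurable (past_algebra (t + 2))" if "s < t" for s t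
  proof -
    have X: "(\<lambda>\<omega>. real (X i r \<omega>)) \<in> borel_measurable (past_algebra (t + 2))" if "r < t + 2" for i r
      using measurable_compose[OF measurable_both_X_past_algebra[OF that], of "\<lambda>z. real (component i z)" borel] by simp
    note [measurable] = X[of "s + 2"] X[of "s + 2 - 1"]
    show ?thesis
      using \<open>s < t\<close> unfolding innov_def[abs_def] resid_def[abs_def]
      by (intro borel_measurable_diff borel_measurable_times borel_measurable_divide borel_measurable_add
          borel_measurable_const X) auto
  qed
qed

lemma phi_CLS_eq:
  assumes n: "2 \<le> n"
  shows "phi_CLS M X n \<omega> = (\<Sum>t=2..n. (real (X 1 t \<omega>) - cond_mean M X 1 t \<omega>) *
      (real (X 2 t \<omega>) - cond_mean M X 2 t \<omega>)) / real (n - 1)"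
  unfolding phi_CLS_def S2_def[abs_def] using n by (subst arg_min_sum_squares) auto

lemma measurable_phi_CLS: "2 \<le> n \<Longrightarrow> phi_CLS M X n \<in> borel_measurable M"
proof -
  assume n: "2 \<le> n"
  have "cond_mean M X i t \<in> borel_measurable M" for i t
    unfolding cond_mean_def[abs_def] by simp
  then show ?thesis
    unfolding phi_CLS_eq[OF n, abs_def] by measurable
qed

text \<open>Conditional means are determined only up to null sets; countability of time gives one
  exceptional set for all \<open>n\<close>. With \<open>Suc n\<close> observations there are exactly
  \<open>n\<close> summands.\<close>

lemma AE_phi_CLS_eq:
  "AE \<omega> in M. \<forall>n>0. phi_CLS M X (Suc n) \<omega> = (\<Sum>k<n. innov (k + 2) \<omega>) / n + \<phi>"
proof -
  have "AE \<omega> in M. \<forall>t\<in>{1..}. cond_mean M X i t \<omega> = m i * (real (X i (t - 1) \<omega>) + 1) / l + \<mu> i" for i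
    by (subst AE_ball_countable) (simp, intro ballI AE_cond_mean_eq, simp)
  from this[of 1] this[of 2] show ?thesis
  proof eventually_elim
    case (elim \<omega>)
    show ?case
    proof (intro allI impI)
      fix n :: nat assume n: "0 < n"
      have "(\<Sum>t=2..Suc n. (real (X 1 t \<omega>) - cond_mean M X 1 t \<omega>) * (real (X 2 t \<omega>) - cond_mean M X 2 t \<omega>)) =
          (\<Sum>t=2..Suc n. innov t \<omega> + \<phi>)"
        using elim by (intro sum.cong) (auto simp: innov_def resid_def diff_diff_eq)
      also have "\<dots> = (\<Sum>k<n. innov (k + 2) \<omega> + \<phi>)"
        by (rule sum.reindex_bij_witness[of _ "\<lambda>k. k + 2" "\<lambda>t. t - 2"]) (auto simp del: add_2_eq_Suc add_2_eq_Suc')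
      also have "\<dots> = (\<Sum>k<n. innov (k + 2) \<omega>) + n * \<phi>" by (simp add: sum.distrib)
      finally show "phi_CLS M X (Suc n) \<omega> = (\<Sum>k<n. innov (k + 2) \<omega>) / n + \<phi>"
        using n by (simp add: phi_CLS_eq add_divide_distrib)
    qed
  qed
qed

text \<open>\<open>innov 1\<close> as a measurable function of the trajectory, since stationarity
  and ergodicity speak about the path law.\<close>

definition path_innov :: "(nat \<Rightarrow> nat \<times> nat) \<Rightarrow> real" where
  "path_innov x =
    (real (component 1 (x 1)) - m 1 * (real (component 1 (x 0)) + 1) / l - \<mu> 1) *
    (real (component 2 (x 1)) - m 2 * (real (component 2 (x 0)) + 1) / l - \<mu> 2) - \<phi>"

lemma measurable_path_innov [measurable]: "path_innov \<in> borel_measurable (Pi\<^sub>M UNIV (\<lambda>_. count_space UNIV))"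
proof -
  have [measurable]: "(\<lambda>x. real (component i (x s))) \<in> borel_measurable (Pi\<^sub>M UNIV (\<lambda>_. count_space UNIV))" for i and s :: nat
    by (rule measurable_compose[OF measurable_component_singleton[of s UNIV "\<lambda>_. count_space UNIV"]]) auto
  show ?thesis unfolding path_innov_def[abs_def] by measurable
qed

lemma path_innov_eq: "path_innov (\<lambda>t. both X (t + k) \<omega>) = innov (k + 1) \<omega>"
  by (simp add: path_innov_def innov_def resid_def)

context
  assumes stat: "strictly_stationary M (count_space UNIV) (both X)"
    and erg: "ergodic_process M (count_space UNIV) (both X)"
begin

text \<open>This makes \<open>delta2\<close> independent of the time at which it is
  evaluated.\<close>

lemma expectation_innov_squared: "1 \<le> t \<Longrightarrow> expectation (\<lambda>\<omega>. (innov t \<omega>)\<^sup>2) = expectation (\<lambda>\<omega>. (innov 1 \<omega>)\<^sup>2)"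
  using strictly_stationary_expectation[OF _ stat, of "\<lambda>x. (path_innov x)\<^sup>2" "t - 1"]
    path_innov_eq[of "t - 1"] path_innov_eq[of 0]
  by simp

text \<open>\<open>path_innov\<close> reads off time \<open>1\<close>, whereas the averages start at
  time \<open>2\<close>; the extra \<open>path_shift\<close> bridges this.\<close>

lemma innov_averages:
  assumes g: "g \<in> borel_measurable borel" and int: "integrable M (\<lambda>\<omega>. g (innov 2 \<omega>))"
  shows "AE \<omega> in M. (\<lambda>n. (\<Sum>k<n. g (innov (k + 2) \<omega>)) / n) \<longlonglongrightarrow> expectation (\<lambda>\<omega>. g (innov 2 \<omega>) :: real)"
proof -
  have eq: "path_innov (path_shift (\<lambda>t. both X (t + k) \<omega>)) = innov (k + 2) \<omega>" for k \<omega>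
    using path_innov_eq[of "Suc k" \<omega>] by (simp add: path_shift_def)
  have eq_0: "path_innov (path_shift (\<lambda>t. both X t \<omega>)) = innov 2 \<omega>" for \<omega>
    using eq[of 0 \<omega>] by (simp only: add_0_right add_0_left)
  have "AE \<omega> in M. (\<lambda>n. (\<Sum>k<n. g (path_innov (path_shift (\<lambda>t. both X (t + k) \<omega>)))) / n) \<longlonglongrightarrow>
      expectation (\<lambda>\<omega>. g (path_innov (path_shift (\<lambda>t. both X t \<omega>))))"
  proof (rule ergodic_process_averages[OF _ stat erg, where g="\<lambda>x. g (path_innov (path_shift x))"])
    show "integrable M (\<lambda>\<omega>. g (path_innov (path_shift (\<lambda>t. both X t \<omega>))))"
      using int by (simp only: eq_0)
  qed (use g in measurable)
  then show ?thesis by (simp only: eq eq_0)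
qed

lemma phi_CLS_strongly_consistent: "AE \<omega> in M. (\<lambda>n. phi_CLS M X n \<omega>) \<longlonglongrightarrow> \<phi>"
proof -
  have "AE \<omega> in M. (\<lambda>n. (\<Sum>k<n. innov (k + 2) \<omega>) / n) \<longlonglongrightarrow> expectation (innov 2)"
    using innov_averages[of "\<lambda>x. x"] sq_integrable_integrable[OF sq_integrable_innov] by simp
  moreover have "expectation (innov 2) = 0"
    using expectation_past_mult_innov[of 2 "\<lambda>_. 1"] by simp
  ultimately have "AE \<omega> in M. (\<lambda>n. (\<Sum>k<n. innov (k + 2) \<omega>) / n) \<longlonglongrightarrow> 0" by simp
  with AE_phi_CLS_eq show ?thesis
  proof eventually_elim
    case (elim \<omega>)
    have "(\<lambda>n. (\<Sum>k<n. innov (k + 2) \<omega>) / n + \<phi>) \<longlonglongrightarrow> 0 + \<phi>"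
      by (intro tendsto_intros elim)
    moreover have "eventually (\<lambda>n. (\<Sum>k<n. innov (k + 2) \<omega>) / n + \<phi> = phi_CLS M X (Suc n) \<omega>) sequentially"
      using eventually_gt_at_top[of 0] by eventually_elim (use elim in simp)
    ultimately have "(\<lambda>n. phi_CLS M X (Suc n) \<omega>) \<longlonglongrightarrow> \<phi>"
      by (simp add: tendsto_cong)
    then show ?case by (rule LIMSEQ_imp_Suc)
  qed
qed

lemma phi_CLS_asymptotically_normal:
  assumes t: "1 \<le> t"
  shows "weak_conv_m (\<lambda>n. distr M borel (\<lambda>\<omega>. sqrt (real n - 1) * (phi_CLS M X n \<omega> - \<phi>)))
    (normal_law 0 (delta2 M l m \<mu> \<phi> X t))"
proof -
  have delta2: "delta2 M l m \<mu> \<phi> X t = expectation (\<lambda>\<omega>. (innov t \<omega>)\<^sup>2)"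
    by (simp add: delta2_def innov_def resid_def)
  have var: "expectation (\<lambda>\<omega>. (innov (k + 2) \<omega>)\<^sup>2) = delta2 M l m \<mu> \<phi> X t" for k
    using expectation_innov_squared[of "k + 2"] expectation_innov_squared[OF t] by (simp add: delta2)
  have "weak_conv_m (\<lambda>n. distr M borel (\<lambda>x. (\<Sum>k<n. innov (k + 2) x) / sqrt n))
      (normal_law 0 (delta2 M l m \<mu> \<phi> X t))"
  proof (rule innov.martingale_clt)
    \<comment> \<open>By stationarity the same number serves as the uniform bound on the variances
      and as the almost sure limit of the averaged squares.\<close>
    show "expectation (\<lambda>\<omega>. (innov (k + 2) \<omega>)\<^sup>2) \<le> delta2 M l m \<mu> \<phi> X t" for k
      by (simp only: var order_refl)
    show "AE x in M. (\<lambda>n. (\<Sum>k<n. (innov (k + 2) x)\<^sup>2) / n) \<longlonglongrightarrow> delta2 M l m \<mu> \<phi> X t"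
      using innov_averages[of "\<lambda>x. x\<^sup>2"] sq_integrable_innov[of 2] var[of 0, unfolded add_0_left]
      by (simp add: sq_integrable_def)
  qed
  then show ?thesis
  proof (rule weak_conv_m_Suc_cong)
    fix n :: nat assume n: "0 < n"
    have [measurable]: "phi_CLS M X (Suc n) \<in> borel_measurable M"
      by (rule measurable_phi_CLS) (use n in simp)
    have [measurable]: "innov k \<in> borel_measurable M" for k
      using sq_integrable_innov by (simp add: sq_integrable_def)
    \<comment> \<open>The estimator is an average of \<open>innov\<close> only almost surely, which
      is enough for equality of laws.\<close>
    show "distr M borel (\<lambda>\<omega>. sqrt (real (Suc n) - 1) * (phi_CLS M X (Suc n) \<omega> - \<phi>)) =
        distr M borel (\<lambda>x. (\<Sum>k<n. innov (k + 2) x) / sqrt n)"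
    proof (rule distr_cong_AE)
      show "AE x in M. sqrt (real (Suc n) - 1) * (phi_CLS M X (Suc n) x - \<phi>) = (\<Sum>k<n. innov (k + 2) x) / sqrt n"
        using AE_phi_CLS_eq
      proof eventually_elim
        case (elim x)
        let ?S = "\<Sum>k<n. innov (k + 2) x"
        have root: "sqrt n / n = 1 / sqrt n" using n by (simp add: field_simps)
        have S: "phi_CLS M X (Suc n) x - \<phi> = ?S / n" using elim n by simp
        have "sqrt (real (Suc n) - 1) * (phi_CLS M X (Suc n) x - \<phi>) = ?S * (sqrt n / n)"
          unfolding S by simp
        then show ?case unfolding root by simp
      qed
    qed measurable
  qed
qed

end

end

theorem theorem3p2:
  fixes M :: "'a measure"
    and l \<phi> :: real
    and m \<mu> \<sigma>Z2 :: "2 \<Rightarrow> real"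
    and fZ :: "(nat \<times> nat) pmf"
    and \<alpha> :: "2 \<Rightarrow> nat \<Rightarrow> 'a \<Rightarrow> real"
    and G :: "2 \<Rightarrow> nat \<Rightarrow> nat \<Rightarrow> 'a \<Rightarrow> nat"
    and Z X :: "2 \<Rightarrow> nat \<Rightarrow> 'a \<Rightarrow> nat"
  assumes "brcmnbinar M l m \<mu> \<sigma>Z2 \<phi> fZ \<alpha> G Z X"
    and "strictly_stationary M (count_space UNIV) (both X)"
    and "ergodic_process M (count_space UNIV) (both X)"
    and "\<And>i t. integrable M (\<lambda>\<omega>. \<bar>real (X i t \<omega>)\<bar> ^ 4)"
  shows "(\<forall>i. \<forall>t\<ge>1. AE \<omega> in M.
            cond_mean M X i t \<omega> = m i * (real (X i (t - 1) \<omega>) + 1) / l + \<mu> i) \<and>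
         (AE \<omega> in M. (\<lambda>n. phi_CLS M X n \<omega>) \<longlonglongrightarrow> \<phi>) \<and>
         (\<forall>t\<ge>1. weak_conv_m
            (\<lambda>n. distr M borel (\<lambda>\<omega>. sqrt (real n - 1) * (phi_CLS M X n \<omega> - \<phi>)))
            (normal_law 0 (delta2 M l m \<mu> \<phi> X t)))"
proof -
  interpret brcmnbinar_fourth_moments M l m \<mu> \<sigma>Z2 \<phi> fZ \<alpha> G Z X
    using assms(1,4) by (intro brcmnbinar_fourth_moments.intro brcmnbinar_fourth_moments_axioms.intro)
  show ?thesis
    by (intro conjI allI impI AE_cond_mean_eq phi_CLS_strongly_consistent[OF assms(2,3)]
      phi_CLS_asymptotically_normal[OF assms(2,3)])
qed

end
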